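(* Let $\mu_0,\mu_1\in\mathcal P_2(\mathbb R^d)$ have means $m_0,m_1$ and variances $\sigma_0^2,\sigma_1^2>0$, and put $n=|m_1-m_0|$. For fixed $\sigma_0,\sigma_1>0$, as $n\to0$, $$\mathcal D^{\mathrm{var}}(\mu_0,\mu_1)^2=\frac12|\log\sigma_0-\log\sigma_1|^2+\frac{\log\sigma_0^2-\log\sigma_1^2}{\sigma_0^2-\sigma_1^2}\,\frac{n^2}2+O(n^4),$$ and, as $n\to\infty$, $$\mathcal D^{\mathrm{var}}(\mu_0,\mu_1)^2=\frac12\left|\log\left(\frac{\sigma_0\sigma_1}{n^2}+O(n^{-4})\right)\right|^2.$$
   Context: $\mathcal P_2(\mathbb R^d)$: Borel probability measures with finite second moment; the mean is $\mathrm M(\mu)=\int x\,d\mu$ and $\operatorname{var}(\mu)=\int|x-\mathrm M(\mu)|^2d\mu$. $\mathcal D^{\mathrm{var}}(\mu_0,\mu_1)^2=\inf\int_0^1\frac{|\dot m_t|^2+|\dot\sigma_t|^2}{2\sigma_t^2}dt$ over absolutely continuous $m:[0,1]\to\mathbb R^d$, $\sigma:[0,1]\to[0,\infty)$ with $m(i)=\mathrm M(\mu_i)$, $\sigma(i)^2=\operatorname{var}(\mu_i)$, $i=0,1$. It depends on $\mu_0,\mu_1$ only through $n,\sigma_0,\sigma_1$. If $\sigma_0=\sigma_1=\sigma$, the quotient $\frac{\log\sigma_0^2-\log\sigma_1^2}{\sigma_0^2-\sigma_1^2}$ is understood as its limit value $\sigma^{-2}$. *)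

theory Defs
  imports "HOL-Probability.Probability" "HOL-Library.Landau_Symbols"
begin

definition P2 :: "(real ^ 'd) measure \<Rightarrow> bool" where
  "P2 \<mu> \<longleftrightarrow> prob_space \<mu> \<and> sets \<mu> = sets borel \<and> integrable \<mu> (\<lambda>x. (norm x)\<^sup>2)"

definition mean :: "(real ^ 'd) measure \<Rightarrow> real ^ 'd" where
  "mean \<mu> = (\<integral>x. x \<partial>\<mu>)"

definition var :: "(real ^ 'd) measure \<Rightarrow> real" where
  "var \<mu> = (\<integral>x. (norm (x - mean \<mu>))\<^sup>2 \<partial>\<mu>)"

(* The usual epsilon-delta definition; the families of non-overlapping compact subintervals
   are the divisions of their own union, and Inf k, Sup k are the end points of k. *)
definition abs_cont_on :: "real set \<Rightarrow> (real \<Rightarrow> 'a::real_normed_vector) \<Rightarrow> bool" where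
  "abs_cont_on S f \<longleftrightarrow> (\<forall>\<epsilon>>0. \<exists>\<delta>>0. \<forall>D. D division_of \<Union>D \<and> \<Union>D \<subseteq> S \<and> (\<Sum>k\<in>D. Sup k - Inf k) < \<delta>
     \<longrightarrow> (\<Sum>k\<in>D. norm (f (Sup k) - f (Inf k))) < \<epsilon>)"

(* An absolutely continuous curve on [0,1] together with (a version of) its derivative. The
   derivative exists almost everywhere, by Lebesgue's theorem, and is determined up to a null set. *)
definition ac_curve :: "(real \<Rightarrow> 'a::euclidean_space) \<Rightarrow> (real \<Rightarrow> 'a) \<Rightarrow> bool" where
  "ac_curve f f' \<longleftrightarrow> abs_cont_on {0..1} f \<and>
     (AE t in lborel. t \<in> {0..1} \<longrightarrow> (f has_vector_derivative f' t) (at t within {0..1}))"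

(* The quotient is taken in [0,\<infinity>]: a/0 = \<infinity> for a > 0, and 0/0 = 0. If one of the end points
   of s is positive and s vanishes somewhere, the energy is infinite in either convention
   for 0/0. *)
definition energy :: "(real \<Rightarrow> real ^ 'd) \<Rightarrow> (real \<Rightarrow> real) \<Rightarrow> (real \<Rightarrow> real) \<Rightarrow> ennreal" where
  "energy m' s s' =
     (\<integral>\<^sup>+t\<in>{0..1}. (ennreal ((norm (m' t))\<^sup>2 + \<bar>s' t\<bar>\<^sup>2) / ennreal (2 * (s t)\<^sup>2)) \<partial>lborel)"

definition Dvar_sq :: "(real ^ 'd) measure \<Rightarrow> (real ^ 'd) measure \<Rightarrow> ennreal" where
  "Dvar_sq \<mu>0 \<mu>1 = Inf {energy m' s s' | m m' s s'.
     ac_curve m m' \<and> ac_curve s s' \<and> (\<forall>t\<in>{0..1}. 0 \<le> s t) \<and>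
     m 0 = mean \<mu>0 \<and> m 1 = mean \<mu>1 \<and> (s 0)\<^sup>2 = var \<mu>0 \<and> (s 1)\<^sup>2 = var \<mu>1}"

definition log_quotient :: "real \<Rightarrow> real \<Rightarrow> real" where
  "log_quotient \<sigma>0 \<sigma>1 =
     (if \<sigma>0 = \<sigma>1 then 1 / \<sigma>0\<^sup>2 else (ln (\<sigma>0\<^sup>2) - ln (\<sigma>1\<^sup>2)) / (\<sigma>0\<^sup>2 - \<sigma>1\<^sup>2))"

end

theory Submission
  imports Defs "HOL-Real_Asymp.Real_Asymp"
begin

text \<open>
  The functional that is minimised is half the action of the curve \<open>(m, \<sigma>)\<close> in the upper half-space
  with the hyperbolic metric \<open>(|dm|\<^sup>2 + d\<sigma>\<^sup>2) / \<sigma>\<^sup>2\<close>. So its infimum is \<open>d\<^sup>2 / 2\<close>, where \<open>d\<close> is the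
  hyperbolic distance of \<open>(m0, \<sigma>0)\<close> and \<open>(m1, \<sigma>1)\<close>, that is, \<open>cosh d = (\<sigma>0\<^sup>2 + \<sigma>1\<^sup>2 + n\<^sup>2) / (2 \<sigma>0 \<sigma>1)\<close>
  (\<open>Dvar_sq_eq_arcosh\<close>). Both expansions are expansions of this closed formula: as \<open>n\<close> tends to \<open>0\<close>, one
  expands \<open>arcosh\<^sup>2\<close> to first order in \<open>n\<^sup>2\<close> (\<open>arcosh_square_near_0\<close>), and as \<open>n\<close> tends to infinity,
  \<open>exp (- d)\<close> is \<open>\<sigma>0 \<sigma>1 / n\<^sup>2\<close> up to an error of order \<open>1 / n ^ 4\<close> (\<open>exp_minus_arcosh_asymp\<close>).

  The upper bound for the infimum comes from an explicit geodesic of constant speed. The lower bound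
  is a calibration: if \<open>\<xi>\<close> is an end of the complete geodesic through the two points, then the
  Busemann function \<open>ln ((|m - \<xi>|\<^sup>2 + \<sigma>\<^sup>2) / \<sigma>)\<close> has a gradient of hyperbolic norm one and changes by
  exactly \<open>d\<close>, up to sign, along the geodesic; its increment along any competitor is thus bounded
  by the length of the competitor, hence by the square root of twice the energy
  (\<open>energy_ge_busemann\<close>). For absolutely continuous competitors this rests on the fundamental
  theorem of calculus in the form \<open>has_integral_derivative_abs_cont\<close>. A competitor that touches
  \<open>\<sigma> = 0\<close> has infinite energy (\<open>energy_infinite_if_vanishing\<close>).
\<close>

section \<open>Absolutely continuous functions\<close>

lemma abs_cont_onE:
  assumes "abs_cont_on S f" "\<epsilon> > 0"
  obtains \<delta> where "\<delta> > 0"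
    "\<forall>D. D division_of \<Union>D \<and> \<Union>D \<subseteq> S \<and> (\<Sum>k\<in>D. Sup k - Inf k) < \<delta>
       \<longrightarrow> (\<Sum>k\<in>D. norm (f (Sup k) - f (Inf k))) < \<epsilon>"
  using assms unfolding abs_cont_on_def by blast

lemma abs_cont_on_subset:
  assumes "abs_cont_on S f" "T \<subseteq> S"
  shows "abs_cont_on T f"
  using assms unfolding abs_cont_on_def by (meson order_trans)

lemma division_endpoints:
  fixes D :: "real set set"
  assumes "D division_of \<Union>D" "\<Union>D \<subseteq> S" "k \<in> D"
  shows "Inf k \<in> S" "Sup k \<in> S" "Inf k \<le> Sup k" "measure lborel k = Sup k - Inf k" "k = {Inf k..Sup k}"
proof -
  have ne: "k \<noteq> {}" using division_ofD(3)[OF assms(1,3)] .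
  obtain c d where "k = cbox c d" 
    using division_ofD(4)[OF assms(1,3)] by blast
  then have k: "k = {c..d}" by simp
  have cd: "c \<le> d" using ne unfolding k by simp
  have "k \<subseteq> S" using assms(2,3) by blast
  then show "Inf k \<in> S" "Sup k \<in> S" "Inf k \<le> Sup k" "measure lborel k = Sup k - Inf k" "k = {Inf k..Sup k}"
    using cd unfolding k by auto
qed

text \<open>A Lipschitz function inflates every increment, hence every sum over a division, by at most a
  constant factor. On a compact interval the logarithm of a positive curve and the squared norm of
  a curve fall under this, because the range of the curve then lies in a set on which they are
  Lipschitz.\<close>
lemma abs_cont_on_compose_lipschitz:
  assumes f: "abs_cont_on S f" and g: "L-lipschitz_on (f ` S) g"
  shows "abs_cont_on S (\<lambda>x. g (f x))"
  unfolding abs_cont_on_def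
proof (intro allI impI)
  fix \<epsilon> :: real assume e: "\<epsilon> > 0"
  have L: "L \<ge> 0" using g by (rule lipschitz_on_nonneg)
  have e2: "\<epsilon> / (L + 1) > 0" using e L by simp
  obtain \<delta> where d: "\<delta> > 0" and *: "\<forall>D. D division_of \<Union>D \<and> \<Union>D \<subseteq> S \<and> (\<Sum>k\<in>D. Sup k - Inf k) < \<delta>
     \<longrightarrow> (\<Sum>k\<in>D. norm (f (Sup k) - f (Inf k))) < \<epsilon> / (L + 1)"
    by (rule abs_cont_onE[OF f e2])
  show "\<exists>\<delta>>0. \<forall>D. D division_of \<Union>D \<and> \<Union>D \<subseteq> S \<and> (\<Sum>k\<in>D. Sup k - Inf k) < \<delta>
     \<longrightarrow> (\<Sum>k\<in>D. norm (g (f (Sup k)) - g (f (Inf k)))) < \<epsilon>"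
  proof (intro exI conjI allI impI, rule d)
    fix D assume D: "D division_of \<Union>D \<and> \<Union>D \<subseteq> S \<and> (\<Sum>k\<in>D. Sup k - Inf k) < \<delta>"
    have "(\<Sum>k\<in>D. norm (g (f (Sup k)) - g (f (Inf k)))) \<le> (\<Sum>k\<in>D. (L + 1) * norm (f (Sup k) - f (Inf k)))"
    proof (rule sum_mono)
      fix k assume "k \<in> D"
      then have "Inf k \<in> S" "Sup k \<in> S" using division_endpoints D by blast+
      then have "norm (g (f (Sup k)) - g (f (Inf k))) \<le> L * norm (f (Sup k) - f (Inf k))"
        by (intro lipschitz_on_normD[OF g]) auto
      then show "norm (g (f (Sup k)) - g (f (Inf k))) \<le> (L + 1) * norm (f (Sup k) - f (Inf k))"
        by (rule order_trans) (simp add: distrib_right)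
    qed
    also have "\<dots> = (L + 1) * (\<Sum>k\<in>D. norm (f (Sup k) - f (Inf k)))"
      by (simp add: sum_distrib_left)
    also have "\<dots> < (L + 1) * (\<epsilon> / (L + 1))"
      using *[rule_format, of D] D L by (intro mult_strict_left_mono) auto
    finally show "(\<Sum>k\<in>D. norm (g (f (Sup k)) - g (f (Inf k)))) < \<epsilon>" using L by simp
  qed
qed

lemma abs_cont_on_add:
  assumes "abs_cont_on S f" "abs_cont_on S g"
  shows "abs_cont_on S (\<lambda>x. f x + g x)"
  unfolding abs_cont_on_def
proof (intro allI impI)
  fix \<epsilon> :: real assume "\<epsilon> > 0"
  then have e: "\<epsilon> / 2 > 0" by simp
  obtain \<delta>1 where d1: "\<delta>1 > 0" and *: "\<forall>D. D division_of \<Union>D \<and> \<Union>D \<subseteq> S \<and> (\<Sum>k\<in>D. Sup k - Inf k) < \<delta>1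
     \<longrightarrow> (\<Sum>k\<in>D. norm (f (Sup k) - f (Inf k))) < \<epsilon> / 2"
    by (rule abs_cont_onE[OF assms(1) e])
  obtain \<delta>2 where d2: "\<delta>2 > 0" and **: "\<forall>D. D division_of \<Union>D \<and> \<Union>D \<subseteq> S \<and> (\<Sum>k\<in>D. Sup k - Inf k) < \<delta>2
     \<longrightarrow> (\<Sum>k\<in>D. norm (g (Sup k) - g (Inf k))) < \<epsilon> / 2"
    by (rule abs_cont_onE[OF assms(2) e])
  show "\<exists>\<delta>>0. \<forall>D. D division_of \<Union>D \<and> \<Union>D \<subseteq> S \<and> (\<Sum>k\<in>D. Sup k - Inf k) < \<delta>
     \<longrightarrow> (\<Sum>k\<in>D. norm (f (Sup k) + g (Sup k) - (f (Inf k) + g (Inf k)))) < \<epsilon>"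
  proof (intro exI[of _ "min \<delta>1 \<delta>2"] conjI allI impI)
    fix D assume D: "D division_of \<Union>D \<and> \<Union>D \<subseteq> S \<and> (\<Sum>k\<in>D. Sup k - Inf k) < min \<delta>1 \<delta>2"
    have "(\<Sum>k\<in>D. norm (f (Sup k) + g (Sup k) - (f (Inf k) + g (Inf k)))) \<le>
      (\<Sum>k\<in>D. norm (f (Sup k) - f (Inf k)) + norm (g (Sup k) - g (Inf k)))"
      by (intro sum_mono) (metis add_diff_add norm_triangle_ineq)
    also have "\<dots> < \<epsilon> / 2 + \<epsilon> / 2"
      unfolding sum.distrib using *[rule_format, of D] **[rule_format, of D] D by (intro add_strict_mono) auto
    finally show "(\<Sum>k\<in>D. norm (f (Sup k) + g (Sup k) - (f (Inf k) + g (Inf k)))) < \<epsilon>" by simp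
  qed (use d1 d2 in auto)
qed

lemma abs_cont_on_id: "abs_cont_on S (\<lambda>x::real. x)"
  unfolding abs_cont_on_def
proof (intro allI impI)
  fix \<epsilon> :: real assume "\<epsilon> > 0"
  have "(\<Sum>k\<in>D. norm (Sup k - Inf k)) = (\<Sum>k\<in>D. Sup k - Inf k)"
    if "D division_of \<Union>D" "\<Union>D \<subseteq> S" for D
    using division_endpoints(3)[OF that] by (intro sum.cong) auto
  then show "\<exists>\<delta>>0. \<forall>D. D division_of \<Union>D \<and> \<Union>D \<subseteq> S \<and> (\<Sum>k\<in>D. Sup k - Inf k) < \<delta>
     \<longrightarrow> (\<Sum>k\<in>D. norm (Sup k - Inf k)) < \<epsilon>"
    using \<open>\<epsilon> > 0\<close> by (intro exI[of _ \<epsilon>]) auto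
qed

lemma abs_cont_on_imp_continuous_on:
  assumes f: "abs_cont_on {a..b} f"
  shows "continuous_on {a..b} f"
  unfolding continuous_on_iff
proof (intro ballI allI impI)
  fix x \<epsilon> :: real assume x: "x \<in> {a..b}" and e: "\<epsilon> > 0"
  obtain \<delta> where d: "\<delta> > 0" and *: "\<forall>D. D division_of \<Union>D \<and> \<Union>D \<subseteq> {a..b} \<and> (\<Sum>k\<in>D. Sup k - Inf k) < \<delta>
     \<longrightarrow> (\<Sum>k\<in>D. norm (f (Sup k) - f (Inf k))) < \<epsilon>"
    by (rule abs_cont_onE[OF f e])
  have **: "norm (f v - f u) < \<epsilon>" if "u \<in> {a..b}" "v \<in> {a..b}" "u \<le> v" "v - u < \<delta>" for u v
  proof -
    have "{{u..v}} division_of \<Union>{{u..v}}" using division_of_self[of u v] that by simp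
    then show ?thesis using *[rule_format, of "{{u..v}}"] that by auto
  qed
  show "\<exists>d>0. \<forall>x'\<in>{a..b}. dist x' x < d \<longrightarrow> dist (f x') (f x) < \<epsilon>"
  proof (intro exI[of _ \<delta>] conjI ballI impI d)
    fix x' assume "x' \<in> {a..b}" "dist x' x < \<delta>"
    then show "dist (f x') (f x) < \<epsilon>"
      using **[of x x'] **[of x' x] x
      by (cases "x \<le> x'") (auto simp: dist_norm norm_minus_commute)
  qed
qed

text \<open>The interiors of the intervals are disjoint, and they have the full measure of the intervals.\<close>
lemma sum_length_division_le_measure:
  fixes D :: "real set set"
  assumes D: "D division_of \<Union>D" and U: "\<Union>D \<subseteq> U" "U \<in> lmeasurable"
  shows "(\<Sum>k\<in>D. Sup k - Inf k) \<le> measure lebesgue U"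
proof -
  have fin: "finite D" using D by auto
  have eq: "Sup k - Inf k = measure lebesgue (interior k)" if "k \<in> D" for k
    using division_endpoints(3)[OF D subset_refl that]
    by (subst (3) division_endpoints(5)[OF D subset_refl that]) (simp add: measure_completion)
  have "(\<Sum>k\<in>D. Sup k - Inf k) = (\<Sum>k\<in>D. measure lebesgue (interior k))"
    using eq by (rule sum.cong[OF refl])
  also have "\<dots> = measure lebesgue (\<Union>k\<in>D. interior k)"
  proof (rule measure_finite_Union[symmetric, OF fin])
    show "disjoint_family_on interior D"
      using division_ofD(5)[OF D] unfolding disjoint_family_on_def by auto
    show "emeasure lebesgue (interior k) \<noteq> \<infinity>" if "k \<in> D" for k
      by (subst division_endpoints(5)[OF D subset_refl that]) (simp add: division_endpoints(3)[OF D subset_refl that])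
  qed auto
  also have "\<dots> \<le> measure lebesgue U"
  proof (rule measure_mono_fmeasurable)
    show "(\<Union>k\<in>D. interior k) \<subseteq> U" using U interior_subset by blast
    have "open (\<Union>k\<in>D. interior k)" by auto
    then show "(\<Union>k\<in>D. interior k) \<in> sets lebesgue" by (simp add: borel_open sets_completionI_sets)
  qed (use U in auto)
  finally show ?thesis .
qed

text \<open>The fundamental theorem of calculus for absolutely continuous functions, with the
  Henstock-Kurzweil integral, for which the proof is a direct choice of gauge. At a point where the
  derivative exists, the gauge is the usual one from the straddle inequality. At a point of the
  exceptional null set, the gauge is an open set \<open>U\<close> of measure less than \<open>\<delta>\<close> that covers the
  null set: the intervals tagged there have total length less than \<open>\<delta>\<close>, so that absolute
  continuity bounds their total increment.\<close>
theorem has_integral_derivative_abs_cont: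
  fixes F :: "real \<Rightarrow> 'a::banach"
  assumes ab: "a \<le> b" and F: "abs_cont_on {a..b} F" and N: "N \<in> null_sets lebesgue"
    and deriv: "\<And>t. t \<in> {a..b} - N \<Longrightarrow> (F has_vector_derivative f t) (at t within {a..b})"
  shows "(f has_integral F b - F a) {a..b}"
proof -
  \<comment> \<open>An integrand that vanishes on \<open>N\<close> contributes nothing to the terms tagged in \<open>N\<close>.\<close>
  define f0 where "f0 t = (if t \<in> N then 0 else f t)" for t
  have "(f0 has_integral F b - F a) {a..b}"
    unfolding has_integral_real
  proof (intro allI impI)
    fix \<epsilon> :: real assume e: "\<epsilon> > 0"
    define e' where "e' = \<epsilon> / (2 * (b - a + 1))"
    have e': "e' > 0" "e' * (b - a) < \<epsilon> / 2"
      using e ab by (auto simp: e'_def field_simps)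
    obtain \<delta> where d: "\<delta> > 0" and AC: "\<forall>D. D division_of \<Union>D \<and> \<Union>D \<subseteq> {a..b} \<and> (\<Sum>k\<in>D. Sup k - Inf k) < \<delta>
     \<longrightarrow> (\<Sum>k\<in>D. norm (F (Sup k) - F (Inf k))) < \<epsilon> / 2"
      by (rule abs_cont_onE[OF F half_gt_zero[OF e]])
    obtain U where U: "open U" "N \<subseteq> U" "U \<in> lmeasurable" "measure lebesgue U < \<delta>"
    proof -
      obtain U where U: "open U" "N \<subseteq> U" "U - N \<in> lmeasurable" "emeasure lebesgue (U - N) < ennreal \<delta>"
        using sets_lebesgue_outer_open[of N \<delta>] N d by auto
      have em: "emeasure lebesgue U = emeasure lebesgue (U - N)"
        using N U by (intro emeasure_Diff_null_set[symmetric]) auto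
      then have "U \<in> lmeasurable" using U
        by (auto simp: fmeasurable_def)
      moreover have "measure lebesgue U < \<delta>"
        using U(4) d unfolding em[symmetric] emeasure_eq_measure2[OF \<open>U \<in> lmeasurable\<close>] 
        by (simp add: ennreal_less_iff)
      ultimately show ?thesis using U that by auto
    qed
    have "\<forall>t\<in>{a..b}-N. \<exists>r>0. \<forall>y\<in>{a..b}. \<bar>y - t\<bar> < r \<longrightarrow> norm (F y - F t - (y - t) *\<^sub>R f t) \<le> e' * \<bar>y - t\<bar>"
      using deriv e' unfolding has_vector_derivative_def has_derivative_within_alt by force
    then obtain r where r: "\<And>t. t \<in> {a..b}-N \<Longrightarrow> r t > 0"
      "\<And>t y. t \<in> {a..b}-N \<Longrightarrow> y \<in> {a..b} \<Longrightarrow> \<bar>y - t\<bar> < r t \<Longrightarrow> norm (F y - F t - (y - t) *\<^sub>R f t) \<le> e' * \<bar>y - t\<bar>"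
      by metis
    define \<gamma> where "\<gamma> t = (if t \<in> N then U else if t \<in> {a..b} then ball t (r t) else ball t 1)" for t
    have "gauge \<gamma>"
      unfolding gauge_def \<gamma>_def using U r by auto
    moreover have "norm ((\<Sum>(x, k)\<in>\<D>. measure lborel k *\<^sub>R f0 x) - (F b - F a)) < \<epsilon>"
      if D: "\<D> tagged_division_of {a..b}" and fine: "\<gamma> fine \<D>" for \<D>
    proof -
      have fin: "finite \<D>" using D by auto
      define err where "err = (\<lambda>(x, k). norm (measure lborel k *\<^sub>R f0 x - (F (Sup k) - F (Inf k))))"
      define D1 where "D1 = {(x, k). (x, k) \<in> \<D> \<and> x \<in> N}"
      have D1: "D1 tagged_partial_division_of {a..b}"
        by (rule tagged_partial_division_subset[of \<D>]) (use D in \<open>auto simp: D1_def tagged_division_of_def\<close>)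
      have div1: "snd ` D1 division_of \<Union>(snd ` D1)"
        by (rule partial_division_of_tagged_division[OF D1])
      have "sum err D1 = (\<Sum>(x, k)\<in>D1. norm (F (Sup k) - F (Inf k)))"
        by (rule sum.cong) (auto simp: D1_def err_def f0_def norm_minus_commute)
      \<comment> \<open>Distinct tags may share a degenerate interval, so that passing from tagged intervals to
        intervals needs a summand that vanishes on these and on the empty set, where \<open>Sup\<close> and \<open>Inf\<close>
        are unspecified.\<close>
      also have "\<dots> = (\<Sum>(x, k)\<in>D1. if k = {} then 0 else norm (F (Sup k) - F (Inf k)))"
        using tagged_partial_division_ofD(2)[OF D1] by (intro sum.cong) (auto, blast)
      also have "\<dots> = (\<Sum>k\<in>snd ` D1. if k = {} then 0 else norm (F (Sup k) - F (Inf k)))"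
        by (rule sum.over_tagged_division_lemma[OF tagged_partial_division_of_Union_self[OF D1]])
           (auto simp: order_le_less)
      also have "\<dots> = (\<Sum>k\<in>snd ` D1. norm (F (Sup k) - F (Inf k)))"
        using tagged_partial_division_ofD(2)[OF D1] by (intro sum.cong) (auto, blast)
      also have "\<dots> < \<epsilon> / 2"
      proof (rule AC[rule_format], intro conjI)
        show "snd ` D1 division_of \<Union>(snd ` D1)" by (rule div1)
        have *: "k \<subseteq> U" if "(x, k) \<in> D1" for x k
          using fineD[OF fine, of x k] that by (auto simp: D1_def \<gamma>_def)
        show "\<Union>(snd ` D1) \<subseteq> {a..b}" using tagged_partial_division_ofD(3)[OF D1] by (force simp del: atLeastAtMost_iff)
        have "(\<Sum>k\<in>snd ` D1. Sup k - Inf k) \<le> measure lebesgue U"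
          by (rule sum_length_division_le_measure[OF div1 _ U(3)]) (use * in force)
        then show "(\<Sum>k\<in>snd ` D1. Sup k - Inf k) < \<delta>" using U by simp
      qed
      finally have 1: "sum err D1 < \<epsilon> / 2" .
      have "sum err (\<D> - D1) \<le> (\<Sum>(x, k)\<in>\<D> - D1. e' * measure lborel k)"
      proof (rule sum_mono, clarify)
        fix x k assume xk: "(x, k) \<in> \<D>" "(x, k) \<notin> D1"
        then have x: "x \<in> {a..b} - N" "k \<subseteq> ball x (r x)" 
          using tagged_division_ofD(2,3)[OF D xk(1)] fineD[OF fine, of x k]
          by (auto simp: D1_def \<gamma>_def split: if_splits)
        obtain u v where k: "k = {u..v}" "u \<le> x" "x \<le> v"
          using tagged_division_ofD(2,4)[OF D xk(1)] by auto
        have uv: "u \<in> {a..b}" "v \<in> {a..b}" "\<bar>u - x\<bar> < r x" "\<bar>v - x\<bar> < r x"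
        proof -
          have "u \<in> k" "v \<in> k" using k by auto
          then have *: "u \<in> {a..b}" "v \<in> {a..b}" "u \<in> ball x (r x)" "v \<in> ball x (r x)"
            using tagged_division_ofD(3)[OF D xk(1)] x(2) by blast+
          show "u \<in> {a..b}" "v \<in> {a..b}" by (rule *)+
          show "\<bar>u - x\<bar> < r x" "\<bar>v - x\<bar> < r x"
            using *(3,4) by (auto simp: dist_real_def abs_minus_commute)
        qed
        have "err (x, k) = norm ((F u - F x - (u - x) *\<^sub>R f x) - (F v - F x - (v - x) *\<^sub>R f x))"
          using k x by (simp add: err_def f0_def algebra_simps)
        also have "\<dots> \<le> norm (F u - F x - (u - x) *\<^sub>R f x) + norm (F v - F x - (v - x) *\<^sub>R f x)"
          by (rule norm_triangle_ineq4)
        also have "\<dots> \<le> e' * \<bar>u - x\<bar> + e' * \<bar>v - x\<bar>"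
          by (intro add_mono r) (use x uv in auto)
        also have "\<dots> = e' * measure lborel k" using k by (simp add: algebra_simps)
        finally show "err (x, k) \<le> e' * measure lborel k" .
      qed
      also have "\<dots> \<le> (\<Sum>(x, k)\<in>\<D>. e' * measure lborel k)"
        using e' by (intro sum_mono2 fin) auto
      also have "\<dots> = e' * (b - a)"
        using additive_content_tagged_division[of \<D> a b] D ab
        by (simp add: sum_distrib_left[symmetric] split_def)
      also have "\<dots> < \<epsilon> / 2" by (rule e')
      finally have 2: "sum err (\<D> - D1) < \<epsilon> / 2" .
      have "(\<Sum>(x, k)\<in>\<D>. measure lborel k *\<^sub>R f0 x) - (F b - F a) =
          (\<Sum>(x, k)\<in>\<D>. measure lborel k *\<^sub>R f0 x - (F (Sup k) - F (Inf k)))"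
        unfolding additive_tagged_division_1[OF ab D, of F, symmetric]
        by (simp add: sum_subtractf split_def)
      also have "norm \<dots> \<le> sum err \<D>"
        unfolding err_def by (rule order_trans[OF norm_sum]) (simp add: split_def)
      also have "\<dots> = sum err D1 + sum err (\<D> - D1)"
        by (subst add.commute, rule sum.subset_diff) (use fin in \<open>auto simp: D1_def\<close>)
      finally show ?thesis using 1 2 by linarith
    qed
    ultimately show "\<exists>\<gamma>. gauge \<gamma> \<and> (\<forall>\<D>. \<D> tagged_division_of {a..b} \<and> \<gamma> fine \<D> \<longrightarrow>
        norm ((\<Sum>(x, k)\<in>\<D>. measure lborel k *\<^sub>R f0 x) - (F b - F a)) < \<epsilon>)"
      by (intro exI[of _ \<gamma>] conjI allI impI) (assumption, elim conjE)
  qed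
  then show ?thesis
    by (rule has_integral_spike[rotated 2, where S = N])
       (use N in \<open>auto simp: f0_def negligible_iff_null_sets\<close>)
qed

text \<open>A function with a Henstock-Kurzweil integral is Lebesgue measurable, and the nonnegative
  integral is the same for a measure and its completion. Hence the bound holds for an integrand
  that is not Borel measurable, such as one that involves an arbitrary version of a derivative.\<close>
lemma ennreal_le_nn_integral_of_has_integral:
  fixes h :: "real \<Rightarrow> real"
  assumes h: "(h has_integral I) S" and S: "S \<in> sets lebesgue"
  shows "ennreal I \<le> (\<integral>\<^sup>+t\<in>S. ennreal (h t) \<partial>lborel)"
proof (cases "(\<integral>\<^sup>+t\<in>S. ennreal (h t) \<partial>lborel) = \<infinity>")
  case False
  \<comment> \<open>the positive part of \<open>h\<close>, which is all that \<open>ennreal\<close> retains\<close>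
  define g where "g t = max 0 (h t * indicator S t)" for t
  have meas: "(\<lambda>x. h x * indicator S x) \<in> borel_measurable lebesgue"
    by (rule has_integral_implies_lebesgue_measurable_real[OF h])
  then have gm: "g \<in> borel_measurable lebesgue" unfolding g_def by measurable
  have eq: "(\<integral>\<^sup>+t\<in>S. ennreal (h t) \<partial>lborel) = (\<integral>\<^sup>+t. ennreal (g t) \<partial>lebesgue)"
    unfolding nn_integral_completion
    by (rule nn_integral_cong) (auto simp: g_def indicator_def max_def ennreal_neg)
  obtain r where r: "(\<integral>\<^sup>+t. ennreal (g t) \<partial>lebesgue) = ennreal r" "r \<ge> 0"
    using False unfolding eq by (cases "(\<integral>\<^sup>+t. ennreal (g t) \<partial>lebesgue)") auto
  have "(g has_integral r) UNIV"
    by (subst has_integral_iff_nn_integral_lebesgue) (use gm r in \<open>auto simp: g_def\<close>)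
  have "((\<lambda>t. if t \<in> S then h t else 0) has_integral I) UNIV"
    using h by (simp add: has_integral_restrict_UNIV)
  then have "I \<le> r"
    by (rule has_integral_le[OF _ \<open>(g has_integral r) UNIV\<close>]) (auto simp: g_def indicator_def)
  then show ?thesis unfolding eq r by (rule ennreal_leI)
qed simp

section \<open>Lower bounds for the energy\<close>

lemma abs_cont_on_ln:
  assumes g: "abs_cont_on {a..b} g" and pos: "\<And>t. t \<in> {a..b} \<Longrightarrow> g t > (0::real)"
  shows "abs_cont_on {a..b} (\<lambda>t. ln (g t))"
proof (cases "a \<le> b")
  case True
  then obtain u where u: "u \<in> {a..b}" and min: "\<And>t. t \<in> {a..b} \<Longrightarrow> g u \<le> g t"
    using continuous_attains_inf[OF compact_Icc _ abs_cont_on_imp_continuous_on[OF g]] by auto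
  define \<delta> where "\<delta> = g u"
  have d: "\<delta> > 0" using pos u by (simp add: \<delta>_def)
  have le: "ln x - ln y \<le> 1 / \<delta> * \<bar>x - y\<bar>" if "\<delta> \<le> x" "\<delta> \<le> y" for x y
  proof -
    have "ln x - ln y \<le> (x - y) / y"
      using that d by (intro ln_diff_le) auto
    also have "\<dots> \<le> \<bar>x - y\<bar> / y" using that d by (intro divide_right_mono) auto
    also have "\<dots> \<le> \<bar>x - y\<bar> / \<delta>" using that d by (intro divide_left_mono) auto
    finally show ?thesis by simp
  qed
  have "(1 / \<delta>)-lipschitz_on (g ` {a..b}) ln"
  proof (rule lipschitz_onI)
    fix x y assume "x \<in> g ` {a..b}" "y \<in> g ` {a..b}"
    then have "\<delta> \<le> x" "\<delta> \<le> y" using min by (auto simp: \<delta>_def)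
    then show "dist (ln x) (ln y) \<le> 1 / \<delta> * dist x y"
      using le[of x y] le[of y x] unfolding dist_real_def abs_minus_commute[of y x] by linarith
  qed (use d in simp)
  then show ?thesis by (rule abs_cont_on_compose_lipschitz[OF g])
next
  case False
  then have "{a..b} = {}" by simp
  moreover have "abs_cont_on {} (\<lambda>t. ln (g t))"
  proof -
    have "D = {}" if "D division_of \<Union>D" "\<Union>D \<subseteq> {}" for D :: "real set set"
      using division_ofD(3)[OF that(1)] that(2) by blast
    then show ?thesis unfolding abs_cont_on_def by (metis sum.empty zero_less_one)
  qed
  ultimately show ?thesis by simp
qed

lemma abs_cont_on_norm_square:
  assumes f: "abs_cont_on {a..b} f"
  shows "abs_cont_on {a..b} (\<lambda>t. (norm (f t - \<xi>))\<^sup>2)"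
proof -
  have "bounded ((\<lambda>t. f t - \<xi>) ` {a..b})"
    by (intro compact_imp_bounded compact_continuous_image continuous_intros
        abs_cont_on_imp_continuous_on[OF f] compact_Icc)
  then obtain B where B: "B > 0" "\<And>t. t \<in> {a..b} \<Longrightarrow> norm (f t - \<xi>) \<le> B"
    unfolding bounded_pos by auto
  have "(2 * B)-lipschitz_on (f ` {a..b}) (\<lambda>x. (norm (x - \<xi>))\<^sup>2)"
  proof (rule lipschitz_onI)
    fix x y assume "x \<in> f ` {a..b}" "y \<in> f ` {a..b}"
    then have xy: "norm (x - \<xi>) \<le> B" "norm (y - \<xi>) \<le> B" using B by auto
    have "dist ((norm (x - \<xi>))\<^sup>2) ((norm (y - \<xi>))\<^sup>2)
        = (norm (x - \<xi>) + norm (y - \<xi>)) * \<bar>norm (x - \<xi>) - norm (y - \<xi>)\<bar>"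
      by (simp add: dist_real_def square_diff_square_factored abs_mult power2_eq_square)
    also have "\<dots> \<le> (2 * B) * norm ((x - \<xi>) - (y - \<xi>))"
      using xy B by (intro mult_mono norm_triangle_ineq3) auto
    finally show "dist ((norm (x - \<xi>))\<^sup>2) ((norm (y - \<xi>))\<^sup>2) \<le> 2 * B * dist x y"
      by (simp add: dist_norm)
  qed (use B in simp)
  then show ?thesis by (rule abs_cont_on_compose_lipschitz[OF f])
qed

text \<open>The calibration argument. If the derivative \<open>D\<close> of \<open>F\<close> along the curve is, in absolute value, at
  most the hyperbolic speed, then \<open>c * D - c\<^sup>2 / 2 \<le> D\<^sup>2 / 2\<close> is at most the energy density for every constant \<open>c\<close>;
  integrating with \<open>c\<close> equal to the increment of \<open>F\<close> gives the claim. The end point \<open>b\<close> is free so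
  that the estimate also applies to a curve that is stopped before it leaves the half-space.\<close>
lemma energy_ge_calibration:
  fixes F :: "real \<Rightarrow> real" and m' :: "real \<Rightarrow> real ^ 'd"
  assumes b: "0 \<le> b" "b \<le> 1" and F: "abs_cont_on {0..b} F"
    and s: "\<And>t. t \<in> {0..b} \<Longrightarrow> s t > 0"
    and deriv: "AE t in lborel. t \<in> {0..b} \<longrightarrow> (\<exists>D. (F has_vector_derivative D) (at t within {0..b})
                  \<and> (D * s t)\<^sup>2 \<le> (norm (m' t))\<^sup>2 + \<bar>s' t\<bar>\<^sup>2)"
  shows "ennreal ((F b - F 0)\<^sup>2 / 2) \<le> energy m' s s'"
proof -
  define good where "good t \<longleftrightarrow> (\<exists>D. (F has_vector_derivative D) (at t within {0..b})
                  \<and> (D * s t)\<^sup>2 \<le> (norm (m' t))\<^sup>2 + \<bar>s' t\<bar>\<^sup>2)" for t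
  obtain N where sub: "{t \<in> space lborel. \<not> (t \<in> {0..b} \<longrightarrow> good t)} \<subseteq> N"
    and "emeasure lborel N = 0" "N \<in> sets lborel"
    by (rule AE_E[OF deriv[folded good_def]])
  then have N: "N \<in> null_sets lborel" by (intro null_setsI)
  have "good t" if "t \<in> {0..b} - N" for t using sub that by (auto simp del: atLeastAtMost_iff)
  then have ex: "\<forall>t\<in>{0..b} - N. \<exists>D. (F has_vector_derivative D) (at t within {0..b})
                  \<and> (D * s t)\<^sup>2 \<le> (norm (m' t))\<^sup>2 + \<bar>s' t\<bar>\<^sup>2"
    unfolding good_def by blast
  obtain f where f: "\<And>t. t \<in> {0..b} - N \<Longrightarrow> (F has_vector_derivative f t) (at t within {0..b})"
    "\<And>t. t \<in> {0..b} - N \<Longrightarrow> (f t * s t)\<^sup>2 \<le> (norm (m' t))\<^sup>2 + \<bar>s' t\<bar>\<^sup>2"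
    using bchoice[OF ex] by blast
  define c where "c = F b - F 0"
  have N': "N \<in> null_sets lebesgue" using N by (simp add: null_sets_completionI)
  have "(f has_integral c) {0..b}"
    unfolding c_def by (rule has_integral_derivative_abs_cont[OF b(1) F N' f(1)])
  then have "((\<lambda>t. c * f t - c\<^sup>2 / 2) has_integral (c * c - b * (c\<^sup>2 / 2))) {0..b}"
    using b by (intro has_integral_diff has_integral_mult_right)
       (use has_integral_const_real[of "c\<^sup>2 / 2" 0 b] in simp_all)
  then have "ennreal (c * c - b * (c\<^sup>2 / 2)) \<le> (\<integral>\<^sup>+t\<in>{0..b}. ennreal (c * f t - c\<^sup>2 / 2) \<partial>lborel)"
    by (rule ennreal_le_nn_integral_of_has_integral) simp
  also have "\<dots> \<le> energy m' s s'"
    unfolding energy_def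
  proof (rule nn_integral_mono_AE, rule AE_I'[OF N], rule subsetI, rule ccontr)
    fix t assume bad: "t \<in> {t \<in> space lborel. \<not> ennreal (c * f t - c\<^sup>2 / 2) * indicator {0..b} t
       \<le> ennreal ((norm (m' t))\<^sup>2 + \<bar>s' t\<bar>\<^sup>2) / ennreal (2 * (s t)\<^sup>2) * indicator {0..1} t}" and "t \<notin> N"
    then have t: "t \<in> {0..b} - N"
      by (cases "t \<in> {0..b}") (simp_all del: atLeastAtMost_iff)
    then have t01: "t \<in> {0..b}" "t \<in> {0..1}" using b by auto
    then have st: "s t > 0" using s by auto
    have "0 \<le> (c - f t)\<^sup>2" by simp
    then have "c * f t - c\<^sup>2 / 2 \<le> (f t)\<^sup>2 / 2" by (simp add: power2_diff)
    also have "\<dots> = (f t * s t)\<^sup>2 / (2 * (s t)\<^sup>2)" using st by (simp add: power_mult_distrib)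
    also have "\<dots> \<le> ((norm (m' t))\<^sup>2 + \<bar>s' t\<bar>\<^sup>2) / (2 * (s t)\<^sup>2)"
      by (intro divide_right_mono f t) simp
    finally have "ennreal (c * f t - c\<^sup>2 / 2) \<le> ennreal ((norm (m' t))\<^sup>2 + \<bar>s' t\<bar>\<^sup>2) / ennreal (2 * (s t)\<^sup>2)"
      using st by (subst divide_ennreal) (auto intro: ennreal_leI)
    then show False using bad t01 by (simp del: atLeastAtMost_iff)
  qed
  finally show ?thesis
  proof (rule order_trans[rotated])
    have "b * (c\<^sup>2 / 2) \<le> 1 * (c\<^sup>2 / 2)" using b by (intro mult_right_mono) auto
    then show "ennreal ((F b - F 0)\<^sup>2 / 2) \<le> ennreal (c * c - b * (c\<^sup>2 / 2))"
      unfolding c_def[symmetric] by (intro ennreal_leI) (simp add: power2_eq_square)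
  qed
qed

lemma energy_ge_ln:
  fixes m' :: "real \<Rightarrow> real ^ 'd"
  assumes s: "ac_curve s s'" and b: "0 \<le> b" "b \<le> 1" and pos: "\<And>t. t \<in> {0..b} \<Longrightarrow> s t > 0"
  shows "ennreal ((ln (s b) - ln (s 0))\<^sup>2 / 2) \<le> energy m' s s'"
proof (rule energy_ge_calibration[OF b _ pos])
  have sub: "{0..b} \<subseteq> {0..1}" using b by auto
  have ac: "abs_cont_on {0..b} s"
    using s sub unfolding ac_curve_def by (blast intro: abs_cont_on_subset)
  show "abs_cont_on {0..b} (\<lambda>t. ln (s t))" by (rule abs_cont_on_ln[OF ac pos])
  have "AE t in lborel. t \<in> {0..1} \<longrightarrow> (s has_vector_derivative s' t) (at t within {0..1})"
    using s unfolding ac_curve_def by blast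
  then show "AE t in lborel. t \<in> {0..b} \<longrightarrow> (\<exists>D. ((\<lambda>t. ln (s t)) has_vector_derivative D) (at t within {0..b})
                  \<and> (D * s t)\<^sup>2 \<le> (norm (m' t))\<^sup>2 + \<bar>s' t\<bar>\<^sup>2)"
  proof (eventually_elim, intro impI)
    fix t assume *: "t \<in> {0..1} \<longrightarrow> (s has_vector_derivative s' t) (at t within {0..1})" and t: "t \<in> {0..b}"
    have "(s has_vector_derivative s' t) (at t within {0..b})"
      using * t sub by (blast intro: has_vector_derivative_within_subset)
    then have "((\<lambda>t. ln (s t)) has_vector_derivative (s' t / s t)) (at t within {0..b})"
      using pos[OF t] unfolding has_real_derivative_iff_has_vector_derivative[symmetric]
      by (auto intro!: derivative_eq_intros)
    moreover have "(s' t / s t * s t)\<^sup>2 \<le> (norm (m' t))\<^sup>2 + \<bar>s' t\<bar>\<^sup>2"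
      using pos[OF t] by simp
    ultimately show "\<exists>D. ((\<lambda>t. ln (s t)) has_vector_derivative D) (at t within {0..b})
                  \<and> (D * s t)\<^sup>2 \<le> (norm (m' t))\<^sup>2 + \<bar>s' t\<bar>\<^sup>2" by blast
  qed
qed

text \<open>The boundary of the half-space is infinitely far away: to descend to height \<open>s 0 * exp (- K)\<close>
  costs at least \<open>K\<^sup>2 / 2\<close>, and a curve that reaches the boundary does this for every \<open>K\<close>.\<close>
lemma energy_infinite_if_vanishing:
  fixes m' :: "real \<Rightarrow> real ^ 'd"
  assumes s: "ac_curve s s'" and s0: "s 0 > 0" and z: "z \<in> {0..1}" "s z \<le> 0"
  shows "energy m' s s' = \<infinity>"
proof -
  have cont: "continuous_on {0..1} s"
    using s unfolding ac_curve_def by (blast intro: abs_cont_on_imp_continuous_on)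
  have *: "ennreal (K\<^sup>2 / 2) \<le> energy m' s s'" if K: "K \<ge> 0" for K
  proof -
    define y where "y = s 0 * exp (- K)"
    have y: "0 < y" "y \<le> s 0" using s0 K by (auto simp: y_def)
    \<comment> \<open>Stop the curve when it first reaches the level \<open>y\<close>; it is positive up to this time.\<close>
    define A where "A = {0..1} \<inter> s -` {..y}"
    have "A \<noteq> {}" using z y by (force simp: A_def)
    moreover have "compact A"
      unfolding compact_eq_bounded_closed A_def
      by (intro conjI bounded_Int continuous_closed_preimage[OF cont]) auto
    ultimately obtain t where tA: "t \<in> A" and minA: "\<forall>u\<in>A. t \<le> u"
      using compact_attains_inf[of A] by blast
    have t: "t \<in> {0..1}" "s t \<le> y" using tA by (auto simp: A_def)
    have first: "t \<le> u" if "u \<in> {0..1}" "s u \<le> y" for u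
      using minA that by (auto simp: A_def)
    have "\<exists>u\<ge>0. u \<le> t \<and> s u = y"
      using t y by (intro IVT2' continuous_on_subset[OF cont]) auto
    then have st: "s t = y" using first t by force
    have "s u > 0" if "u \<in> {0..t}" for u
      using first[of u] that t st y by (cases "u = t") force+
    then have "ennreal ((ln (s t) - ln (s 0))\<^sup>2 / 2) \<le> energy m' s s'"
      using t by (intro energy_ge_ln[OF s]) auto
    moreover have "ln (s t) - ln (s 0) = - K"
      using s0 by (simp add: st y_def ln_mult)
    ultimately show ?thesis by simp
  qed
  show ?thesis
  proof (cases "energy m' s s'")
    case (real r)
    \<comment> \<open>the depth \<open>r + 1\<close> costs more than \<open>r\<close>\<close>
    have "ennreal ((r + 1)\<^sup>2 / 2) \<le> ennreal r" using *[of "r + 1"] real by simp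
    then have "(r + 1)\<^sup>2 / 2 \<le> r" using real by simp
    moreover have "0 \<le> r\<^sup>2" by simp
    ultimately show ?thesis by (simp add: power2_sum)
  qed simp
qed

text \<open>The Busemann function of the hyperbolic half-space for the ideal boundary point \<open>\<xi>\<close>, up to an
  additive constant.\<close>
definition busemann :: "'a::real_normed_vector \<Rightarrow> 'a \<Rightarrow> real \<Rightarrow> real" where
  "busemann \<xi> x r = ln ((norm (x - \<xi>))\<^sup>2 + r\<^sup>2) - ln r"

text \<open>The hyperbolic gradient of a Busemann function has norm one. The left-hand side is the square of
  \<open>r\<close> times its derivative at \<open>(x, r)\<close> in direction \<open>(v, w)\<close>, for \<open>\<xi> = 0\<close>. With \<open>Q = |x|\<^sup>2 + r\<^sup>2\<close> the
  base of this square is \<open>(2 r x \<bullet> v + (r\<^sup>2 - |x|\<^sup>2) w) / Q\<close>, and the inequality is Cauchy-Schwarz, since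
  \<open>4 r\<^sup>2 |x|\<^sup>2 + (r\<^sup>2 - |x|\<^sup>2)\<^sup>2 = Q\<^sup>2\<close>.\<close>
lemma busemann_gradient_le:
  fixes x v :: "'a::real_inner" and r w :: real
  assumes r: "r > 0"
  shows "((2 * (x \<bullet> v) + 2 * r * w) / ((norm x)\<^sup>2 + r\<^sup>2) * r - w)\<^sup>2 \<le> (norm v)\<^sup>2 + w\<^sup>2"
proof -
  define Q where "Q = (norm x)\<^sup>2 + r\<^sup>2"
  define p where "p = x \<bullet> v"
  have Q: "Q > 0" using r by (simp add: Q_def add_nonneg_pos)
  have p: "p\<^sup>2 \<le> (norm x)\<^sup>2 * (norm v)\<^sup>2"
    using Cauchy_Schwarz_ineq2[of x v] unfolding p_def
    by (metis abs_le_square_iff abs_mult abs_norm_cancel power_mult_distrib)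
  have eq: "((2 * p + 2 * r * w) / Q * r - w) * Q = 2 * r * p + (r\<^sup>2 - (norm x)\<^sup>2) * w"
    using Q by (simp add: field_simps) (simp add: Q_def algebra_simps power2_eq_square)
  \<comment> \<open>the mixed term of the square, split by \<open>2 A B \<le> A\<^sup>2 + B\<^sup>2\<close>\<close>
  have amgm: "2 * (2 * r * p) * ((r\<^sup>2 - (norm x)\<^sup>2) * w)
      \<le> (2 * r)\<^sup>2 * (norm x)\<^sup>2 * w\<^sup>2 + (r\<^sup>2 - (norm x)\<^sup>2)\<^sup>2 * (norm v)\<^sup>2"
  proof -
    define A where "A = 2 * r * norm x * \<bar>w\<bar>"
    define B where "B = \<bar>r\<^sup>2 - (norm x)\<^sup>2\<bar> * norm v"
    have "2 * (2 * r * p) * ((r\<^sup>2 - (norm x)\<^sup>2) * w) \<le> \<bar>2 * (2 * r * p) * ((r\<^sup>2 - (norm x)\<^sup>2) * w)\<bar>" by simp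
    also have "\<dots> = 4 * r * \<bar>p\<bar> * (\<bar>r\<^sup>2 - (norm x)\<^sup>2\<bar> * \<bar>w\<bar>)" using r by (simp add: abs_mult)
    also have "\<dots> \<le> 4 * r * (norm x * norm v) * (\<bar>r\<^sup>2 - (norm x)\<^sup>2\<bar> * \<bar>w\<bar>)"
      using r Cauchy_Schwarz_ineq2[of x v] by (intro mult_right_mono mult_left_mono) (auto simp: p_def)
    also have "\<dots> = 2 * A * B" by (simp add: A_def B_def)
    also have "\<dots> \<le> A\<^sup>2 + B\<^sup>2" by (rule sum_squares_bound)
    finally show ?thesis by (simp add: A_def B_def power_mult_distrib)
  qed
  have "((2 * p + 2 * r * w) / Q * r - w)\<^sup>2 * Q\<^sup>2 = (2 * r * p + (r\<^sup>2 - (norm x)\<^sup>2) * w)\<^sup>2"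
    unfolding eq[symmetric] by (simp add: power_mult_distrib)
  also have "\<dots> = 4 * r\<^sup>2 * p\<^sup>2 + 2 * (2 * r * p) * ((r\<^sup>2 - (norm x)\<^sup>2) * w) + (r\<^sup>2 - (norm x)\<^sup>2)\<^sup>2 * w\<^sup>2"
    by (simp add: power2_sum power_mult_distrib)
  also have "\<dots> \<le> 4 * r\<^sup>2 * ((norm x)\<^sup>2 * (norm v)\<^sup>2)
      + ((2 * r)\<^sup>2 * (norm x)\<^sup>2 * w\<^sup>2 + (r\<^sup>2 - (norm x)\<^sup>2)\<^sup>2 * (norm v)\<^sup>2) + (r\<^sup>2 - (norm x)\<^sup>2)\<^sup>2 * w\<^sup>2"
    using p amgm by (intro add_mono mult_left_mono) auto
  also have "\<dots> = ((norm v)\<^sup>2 + w\<^sup>2) * Q\<^sup>2"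
    unfolding Q_def by algebra
  finally show ?thesis using Q unfolding Q_def[symmetric] p_def[symmetric] by simp
qed

lemma energy_ge_busemann:
  fixes m m' :: "real \<Rightarrow> real ^ 'd"
  assumes m: "ac_curve m m'" and s: "ac_curve s s'" and s0: "s 0 > 0"
  shows "ennreal ((busemann \<xi> (m 1) (s 1) - busemann \<xi> (m 0) (s 0))\<^sup>2 / 2) \<le> energy m' s s'"
proof (cases "\<forall>t\<in>{0..1}. s t > 0")
  case False
  then obtain z where "z \<in> {0..1}" "s z \<le> 0" by force
  then show ?thesis by (simp add: energy_infinite_if_vanishing[OF s s0])
next
  case True
  then have pos: "\<And>t. t \<in> {0..1} \<Longrightarrow> s t > 0" by blast
  have Qpos: "(norm (m t - \<xi>))\<^sup>2 + (norm (s t - 0))\<^sup>2 > 0" if "t \<in> {0..1}" for t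
    using pos[OF that] by (simp add: add_nonneg_pos)
  have acm: "abs_cont_on {0..1} m" and acs: "abs_cont_on {0..1} s"
    using m s unfolding ac_curve_def by blast+
  have bus: "busemann \<xi> (m t) (s t) = ln ((norm (m t - \<xi>))\<^sup>2 + (norm (s t - 0))\<^sup>2) + - ln (s t)" for t
    by (simp add: busemann_def)
  show ?thesis
  proof (rule energy_ge_calibration[of 1 "\<lambda>t. busemann \<xi> (m t) (s t)", OF _ _ _ pos])
    show "abs_cont_on {0..1} (\<lambda>t. busemann \<xi> (m t) (s t))"
      unfolding bus
    proof (intro abs_cont_on_add abs_cont_on_ln abs_cont_on_norm_square acm acs Qpos)
      show "abs_cont_on {0..1} (\<lambda>t. - ln (s t))"
        by (rule abs_cont_on_compose_lipschitz[OF abs_cont_on_ln[OF acs pos], of 1])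
           (auto intro!: lipschitz_intros)
    qed
    have "AE t in lborel. t \<in> {0..1} \<longrightarrow> (m has_vector_derivative m' t) (at t within {0..1})"
      "AE t in lborel. t \<in> {0..1} \<longrightarrow> (s has_vector_derivative s' t) (at t within {0..1})"
      using m s unfolding ac_curve_def by blast+
    then show "AE t in lborel. t \<in> {0..1} \<longrightarrow>
       (\<exists>D. ((\<lambda>t. busemann \<xi> (m t) (s t)) has_vector_derivative D) (at t within {0..1})
                  \<and> (D * s t)\<^sup>2 \<le> (norm (m' t))\<^sup>2 + \<bar>s' t\<bar>\<^sup>2)"
    proof (eventually_elim, intro impI)
      fix t assume *: "t \<in> {0..1} \<longrightarrow> (m has_vector_derivative m' t) (at t within {0..1})"
        "t \<in> {0..1} \<longrightarrow> (s has_vector_derivative s' t) (at t within {0..1})" and t: "t \<in> {0..1}"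
      define D where "D = (2 * ((m t - \<xi>) \<bullet> m' t) + 2 * s t * s' t) / ((norm (m t - \<xi>))\<^sup>2 + (s t)\<^sup>2) - s' t / s t"
      have dm: "(m has_derivative (\<lambda>h. h *\<^sub>R m' t)) (at t within {0..1})"
        using * t unfolding has_vector_derivative_def by blast
      have ds: "(s has_real_derivative s' t) (at t within {0..1})"
        using * t unfolding has_real_derivative_iff_has_vector_derivative by blast
      have "((\<lambda>t. (m t - \<xi>) \<bullet> (m t - \<xi>)) has_derivative (\<lambda>h. 2 * ((m t - \<xi>) \<bullet> m' t) * h)) (at t within {0..1})"
        by (rule has_derivative_eq_rhs, rule has_derivative_inner) 
           (rule derivative_eq_intros dm refl | simp add: inner_commute fun_eq_iff algebra_simps)+
      then have dn: "((\<lambda>t. (norm (m t - \<xi>))\<^sup>2) has_real_derivative 2 * ((m t - \<xi>) \<bullet> m' t)) (at t within {0..1})"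
        by (simp add: has_field_derivative_def power2_norm_eq_inner)
      have dQ: "((\<lambda>t. (norm (m t - \<xi>))\<^sup>2 + (s t)\<^sup>2) has_real_derivative
          2 * ((m t - \<xi>) \<bullet> m' t) + 2 * s t * s' t) (at t within {0..1})"
        by (rule DERIV_cong[OF DERIV_add[OF dn DERIV_power[OF ds, of 2]]]) simp
      have "(norm (m t - \<xi>))\<^sup>2 + (s t)\<^sup>2 > 0" using Qpos[OF t] by simp
      from DERIV_diff[OF DERIV_chain2[OF DERIV_ln[OF this] dQ] DERIV_chain2[OF DERIV_ln[OF pos[OF t]] ds]]
      have "((\<lambda>t. busemann \<xi> (m t) (s t)) has_real_derivative D) (at t within {0..1})"
        unfolding busemann_def by (rule DERIV_cong) (simp add: D_def divide_inverse mult.commute)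
      then have "((\<lambda>t. busemann \<xi> (m t) (s t)) has_vector_derivative D) (at t within {0..1})"
        by (simp add: has_real_derivative_iff_has_vector_derivative)
      moreover have "(D * s t)\<^sup>2 \<le> (norm (m' t))\<^sup>2 + \<bar>s' t\<bar>\<^sup>2"
      proof -
        have "D * s t = (2 * ((m t - \<xi>) \<bullet> m' t) + 2 * s t * s' t) / ((norm (m t - \<xi>))\<^sup>2 + (s t)\<^sup>2) * s t - s' t"
          using pos[OF t] by (simp add: D_def left_diff_distrib)
        then show ?thesis using busemann_gradient_le[OF pos[OF t], of "m t - \<xi>" "m' t" "s' t"] by simp
      qed
      ultimately show "\<exists>D. ((\<lambda>t. busemann \<xi> (m t) (s t)) has_vector_derivative D) (at t within {0..1})
                  \<and> (D * s t)\<^sup>2 \<le> (norm (m' t))\<^sup>2 + \<bar>s' t\<bar>\<^sup>2" by blast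
    qed
  qed auto
qed

section \<open>Geodesics and the distance formula\<close>

lemma ac_curve_C1:
  assumes deriv: "\<And>t. t \<in> {0..1} \<Longrightarrow> (f has_vector_derivative f' t) (at t within {0..1})"
    and cont: "continuous_on {0..1} f'"
  shows "ac_curve f f'"
proof -
  have "bounded (f' ` {0..1})"
    by (intro compact_imp_bounded compact_continuous_image cont compact_Icc)
  then obtain B where B: "B > 0" "\<And>t. t \<in> {0..1} \<Longrightarrow> norm (f' t) \<le> B"
    unfolding bounded_pos by auto
  have "B-lipschitz_on {0..1} f"
  proof (rule bounded_derivative_imp_lipschitz)
    fix t :: real assume t: "t \<in> {0..1}"
    show "(f has_derivative (\<lambda>h. h *\<^sub>R f' t)) (at t within {0..1})"
      using deriv[OF t] by (simp add: has_vector_derivative_def)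
    have "norm (h *\<^sub>R f' t) \<le> B * norm h" for h
      using mult_left_mono[OF B(2)[OF t], of "\<bar>h\<bar>"] by (simp add: mult.commute)
    then show "onorm (\<lambda>h. h *\<^sub>R f' t) \<le> B" using B by (intro onorm_bound) auto
  qed (use B in auto)
  then have "abs_cont_on {0..1} f"
    by (intro abs_cont_on_compose_lipschitz[OF abs_cont_on_id]) simp
  then show ?thesis unfolding ac_curve_def using deriv by auto
qed

lemma energy_constant_speed:
  fixes m' :: "real \<Rightarrow> real ^ 'd"
  assumes "\<And>t. t \<in> {0..1} \<Longrightarrow> s t > 0"
    and "\<And>t. t \<in> {0..1} \<Longrightarrow> (norm (m' t))\<^sup>2 + \<bar>s' t\<bar>\<^sup>2 = L\<^sup>2 * (s t)\<^sup>2"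
  shows "energy m' s s' = ennreal (L\<^sup>2 / 2)"
proof -
  have "energy m' s s' = (\<integral>\<^sup>+t. ennreal (L\<^sup>2 / 2) * indicator {0..1::real} t \<partial>lborel)"
    unfolding energy_def
  proof (rule nn_integral_cong)
    fix t :: real
    show "ennreal ((norm (m' t))\<^sup>2 + \<bar>s' t\<bar>\<^sup>2) / ennreal (2 * (s t)\<^sup>2) * indicator {0..1} t
        = ennreal (L\<^sup>2 / 2) * indicator {0..1} t"
    proof (cases "t \<in> {0..1}")
      case True
      have "ennreal (L\<^sup>2 * (s t)\<^sup>2) / ennreal (2 * (s t)\<^sup>2) = ennreal (L\<^sup>2 * (s t)\<^sup>2 / (2 * (s t)\<^sup>2))"
        using assms(1)[OF True] by (intro divide_ennreal) auto
      also have "L\<^sup>2 * (s t)\<^sup>2 / (2 * (s t)\<^sup>2) = L\<^sup>2 / 2"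
        using assms(1)[OF True] by simp
      finally show ?thesis unfolding assms(2)[OF True] by simp
    qed simp
  qed
  also have "\<dots> = ennreal (L\<^sup>2 / 2)"
    by (subst nn_integral_cmult_indicator) auto
  finally show ?thesis .
qed

lemma Dvar_sq_le:
  assumes m: "ac_curve m m'" "m 0 = mean \<mu>0" "m 1 = mean \<mu>1"
    and s: "ac_curve s s'" "(s 0)\<^sup>2 = var \<mu>0" "(s 1)\<^sup>2 = var \<mu>1"
    and pos: "\<And>t. t \<in> {0..1} \<Longrightarrow> s t > 0"
    and speed: "\<And>t. t \<in> {0..1} \<Longrightarrow> (norm (m' t))\<^sup>2 + \<bar>s' t\<bar>\<^sup>2 = L\<^sup>2 * (s t)\<^sup>2"
  shows "Dvar_sq \<mu>0 \<mu>1 \<le> ennreal (L\<^sup>2 / 2)"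
  unfolding Dvar_sq_def
proof (rule Inf_lower, rule CollectI, rule exI[of _ m], rule exI[of _ m'], rule exI[of _ s], rule exI[of _ s'],
    intro conjI ballI)
  show "0 \<le> s t" if "t \<in> {0..1}" for t using pos[OF that] by simp
  show "ennreal (L\<^sup>2 / 2) = energy m' s s'"
    using pos speed by (rule energy_constant_speed[symmetric])
qed (use m s in auto)

lemma Dvar_sq_ge_busemann:
  assumes v: "var \<mu>0 = \<sigma>0\<^sup>2" "var \<mu>1 = \<sigma>1\<^sup>2" and pos: "\<sigma>0 > 0" "\<sigma>1 > 0"
  shows "ennreal ((busemann \<xi> (mean \<mu>1) \<sigma>1 - busemann \<xi> (mean \<mu>0) \<sigma>0)\<^sup>2 / 2) \<le> Dvar_sq \<mu>0 \<mu>1"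
  unfolding Dvar_sq_def
proof (rule Inf_greatest, clarify)
  fix m m' s s'
  assume m: "ac_curve m m'" "m 0 = mean \<mu>0" "m 1 = mean \<mu>1" and s: "ac_curve s s'"
    and s_pos: "\<forall>t\<in>{0..1}. 0 \<le> s t" and e: "(s 0)\<^sup>2 = var \<mu>0" "(s 1)\<^sup>2 = var \<mu>1"
  have s01: "s 0 = \<sigma>0" "s 1 = \<sigma>1"
    using s_pos e v pos by (auto intro: power2_eq_imp_eq)
  have "s 0 > 0" using s01 pos by simp
  from energy_ge_busemann[OF m(1) s this, of \<xi>]
  show "ennreal ((busemann \<xi> (mean \<mu>1) \<sigma>1 - busemann \<xi> (mean \<mu>0) \<sigma>0)\<^sup>2 / 2) \<le> energy m' s s'"
    by (simp add: m s01)
qed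

text \<open>Over a common mean the geodesic is the vertical segment, with a logarithmically affine height.
  The Busemann function for the foot of the segment restricts to \<open>ln\<close> on it, so that it certifies
  minimality.\<close>
lemma Dvar_sq_vertical:
  assumes v: "var \<mu>0 = \<sigma>0\<^sup>2" "var \<mu>1 = \<sigma>1\<^sup>2" and pos: "\<sigma>0 > 0" "\<sigma>1 > 0"
    and eq: "mean \<mu>1 = mean \<mu>0"
  shows "Dvar_sq \<mu>0 \<mu>1 = ennreal ((ln \<sigma>1 - ln \<sigma>0)\<^sup>2 / 2)"
proof (rule antisym)
  define L where "L = ln \<sigma>1 - ln \<sigma>0"
  define s where "s t = \<sigma>0 * exp (t * L)" for t
  have "(s has_real_derivative L * s t) (at t within {0..1})" for t
    unfolding s_def by (auto intro!: derivative_eq_intros)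
  moreover have "continuous_on {0..1} (\<lambda>t. L * s t)"
    unfolding s_def by (intro continuous_intros)
  ultimately have acs: "ac_curve s (\<lambda>t. L * s t)"
    by (intro ac_curve_C1) (auto simp: has_real_derivative_iff_has_vector_derivative[symmetric])
  have acm: "ac_curve (\<lambda>t. mean \<mu>0) (\<lambda>t. 0)"
    by (rule ac_curve_C1) (auto intro!: derivative_eq_intros)
  have "s 0 = \<sigma>0" "s 1 = \<sigma>1" using pos by (auto simp: s_def L_def exp_diff)
  then show "Dvar_sq \<mu>0 \<mu>1 \<le> ennreal ((ln \<sigma>1 - ln \<sigma>0)\<^sup>2 / 2)"
    unfolding L_def[symmetric]
    by (intro Dvar_sq_le[OF acm _ _ acs]) (use v eq pos in \<open>auto simp: power_mult_distrib s_def\<close>)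
  have "busemann (mean \<mu>0) (mean \<mu>1) \<sigma>1 - busemann (mean \<mu>0) (mean \<mu>0) \<sigma>0 = ln \<sigma>1 - ln \<sigma>0"
    using pos by (simp add: busemann_def eq ln_realpow)
  then show "ennreal ((ln \<sigma>1 - ln \<sigma>0)\<^sup>2 / 2) \<le> Dvar_sq \<mu>0 \<mu>1"
    using Dvar_sq_ge_busemann[OF v pos, of "mean \<mu>0"] by simp
qed

text \<open>The geodesic through two points that are not above each other is an arc of a semicircle
  orthogonal to the boundary. Here \<open>\<xi>\<close> is an end of that semicircle, \<open>a\<close> and \<open>b\<close> are the
  horizontal distances of the two points from \<open>\<xi>\<close>, and \<open>(a\<^sup>2 + \<sigma>0\<^sup>2) / a\<close> is its diameter, so that
  the last hypothesis says that both points lie on it. With the parameter \<open>\<tau>\<close> for which \<open>exp \<tau>\<close> is the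
  ratio of horizontal distance to height, the semicircle has unit speed and the Busemann function for
  \<open>\<xi>\<close> equals \<open>\<tau>\<close> up to a constant; hence the same number bounds the energy from both sides.\<close>
lemma Dvar_sq_semicircle:
  fixes e :: "real ^ 'd"
  assumes v: "var \<mu>0 = \<sigma>0\<^sup>2" "var \<mu>1 = \<sigma>1\<^sup>2" and pos: "\<sigma>0 > 0" "\<sigma>1 > 0"
    and e: "norm e = 1" and ab: "a > 0" "b > 0"
    and mean: "mean \<mu>0 = \<xi> + a *\<^sub>R e" "mean \<mu>1 = \<xi> + b *\<^sub>R e"
    and circle: "(a\<^sup>2 + \<sigma>0\<^sup>2) * b = (b\<^sup>2 + \<sigma>1\<^sup>2) * a"
  shows "Dvar_sq \<mu>0 \<mu>1 = ennreal ((ln (b / \<sigma>1) - ln (a / \<sigma>0))\<^sup>2 / 2)"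
proof (rule antisym)
  define L where "L = ln (b / \<sigma>1) - ln (a / \<sigma>0)"
  define \<rho> where "\<rho> = (a\<^sup>2 + \<sigma>0\<^sup>2) / a"
  have \<rho>: "\<rho> > 0" "\<rho> = (b\<^sup>2 + \<sigma>1\<^sup>2) / b"
    using ab pos circle by (auto simp: \<rho>_def field_simps add_pos_pos)
  \<comment> \<open>\<open>E = exp (- \<tau>)\<close>, the ratio of height to horizontal distance, with \<open>\<tau>\<close> affine in time\<close>
  define E where "E t = exp (- (ln (a / \<sigma>0) + t * L))" for t
  have E: "E t > 0" "1 + (E t)\<^sup>2 > 0" for t by (auto simp: E_def add_pos_nonneg)
  have E01: "E 0 = \<sigma>0 / a" "E 1 = \<sigma>1 / b"
    using pos ab by (auto simp: E_def L_def exp_diff exp_minus)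
  have dE: "(E has_real_derivative - L * E t) (at t within {0..1})" for t
    unfolding E_def by (auto intro!: derivative_eq_intros)
  have cE: "continuous_on {0..1} E" unfolding E_def by (intro continuous_intros)
  \<comment> \<open>On the semicircle of diameter \<open>\<rho>\<close> the horizontal distance is \<open>\<rho> / (1 + E\<^sup>2)\<close>, and the height
    is \<open>E\<close> times this.\<close>
  define s where "s t = \<rho> * E t / (1 + (E t)\<^sup>2)" for t
  define s' where "s' t = \<rho> * L * E t * ((E t)\<^sup>2 - 1) / (1 + (E t)\<^sup>2)\<^sup>2" for t
  define w' where "w' t = 2 * \<rho> * L * (E t)\<^sup>2 / (1 + (E t)\<^sup>2)\<^sup>2" for t
  have nz: "1 + (E t)\<^sup>2 \<noteq> 0" for t using E(2)[of t] by simp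
  have "(s has_real_derivative s' t) (at t within {0..1})" for t
    unfolding s_def s'_def
    by (rule DERIV_cong[OF DERIV_divide[OF DERIV_cmult[OF dE] DERIV_add[OF DERIV_const DERIV_power[OF dE, of 2]] nz]])
       (simp add: power2_eq_square algebra_simps)
  moreover have "continuous_on {0..1} s'"
    unfolding s'_def using nz by (intro continuous_intros cE) auto
  ultimately have acs: "ac_curve s s'"
    by (intro ac_curve_C1) (auto simp: has_real_derivative_iff_has_vector_derivative[symmetric])
  have "((\<lambda>t. \<rho> / (1 + (E t)\<^sup>2)) has_real_derivative w' t) (at t within {0..1})" for t
    unfolding w'_def
    by (rule DERIV_cong[OF DERIV_divide[OF DERIV_const DERIV_add[OF DERIV_const DERIV_power[OF dE, of 2]] nz]])
       (simp add: power2_eq_square algebra_simps)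
  from has_vector_derivative_add[OF has_vector_derivative_const has_vector_derivative_scaleR[OF this has_vector_derivative_const]]
  have "((\<lambda>t. \<xi> + (\<rho> / (1 + (E t)\<^sup>2)) *\<^sub>R e) has_vector_derivative w' t *\<^sub>R e) (at t within {0..1})" for t
    by simp
  moreover have "continuous_on {0..1} (\<lambda>t. w' t *\<^sub>R e)"
    unfolding w'_def using nz by (intro continuous_intros cE) auto
  ultimately have acm: "ac_curve (\<lambda>t. \<xi> + (\<rho> / (1 + (E t)\<^sup>2)) *\<^sub>R e) (\<lambda>t. w' t *\<^sub>R e)"
    by (intro ac_curve_C1)
  have sq: "1 + (\<sigma>0 / a)\<^sup>2 = (a\<^sup>2 + \<sigma>0\<^sup>2) / a\<^sup>2" "1 + (\<sigma>1 / b)\<^sup>2 = (b\<^sup>2 + \<sigma>1\<^sup>2) / b\<^sup>2"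
    using ab by (auto simp: field_simps)
  have nz': "a\<^sup>2 + \<sigma>0\<^sup>2 \<noteq> 0" "b\<^sup>2 + \<sigma>1\<^sup>2 \<noteq> 0"
    using ab pos by (auto simp: add_pos_pos pos_add_strict less_imp_neq[symmetric])
  have w0: "\<rho> / (1 + (E 0)\<^sup>2) = a" unfolding E01 sq \<rho>_def using ab nz' by (simp add: power2_eq_square)
  have w1: "\<rho> / (1 + (E 1)\<^sup>2) = b" unfolding E01 sq \<rho>(2) using ab nz' by (simp add: power2_eq_square)
  have s0: "s 0 = \<sigma>0" using w0 ab unfolding s_def
    by (metis E01(1) nonzero_mult_div_cancel_left times_divide_eq_left
        times_divide_eq_right mult.commute less_irrefl)
  have s1: "s 1 = \<sigma>1" using w1 ab unfolding s_def
    by (metis E01(2) nonzero_mult_div_cancel_left times_divide_eq_left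
        times_divide_eq_right mult.commute less_irrefl)
  have speed: "(norm (w' t *\<^sub>R e))\<^sup>2 + \<bar>s' t\<bar>\<^sup>2 = L\<^sup>2 * (s t)\<^sup>2" for t
  proof -
    define x where "x = E t"
    define y where "y = 1 + x\<^sup>2"
    have y: "y \<noteq> 0" using nz[of t] by (simp add: y_def x_def)
    have "(norm (w' t *\<^sub>R e))\<^sup>2 + \<bar>s' t\<bar>\<^sup>2 = (w' t)\<^sup>2 + (s' t)\<^sup>2"
      by (simp add: e)
    also have "\<dots> = (2 * \<rho> * L * x\<^sup>2 / y\<^sup>2)\<^sup>2 + (\<rho> * L * x * (x\<^sup>2 - 1) / y\<^sup>2)\<^sup>2"
      by (simp only: w'_def s'_def x_def y_def)
    also have "\<dots> = ((2 * \<rho> * L * x\<^sup>2)\<^sup>2 + (\<rho> * L * x * (x\<^sup>2 - 1))\<^sup>2) / (y\<^sup>2)\<^sup>2"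
      by (simp add: power_divide add_divide_distrib)
    also have "(2 * \<rho> * L * x\<^sup>2)\<^sup>2 + (\<rho> * L * x * (x\<^sup>2 - 1))\<^sup>2 = L\<^sup>2 * (\<rho> * x)\<^sup>2 * y\<^sup>2"
      unfolding y_def by algebra
    also have "L\<^sup>2 * (\<rho> * x)\<^sup>2 * y\<^sup>2 / (y\<^sup>2)\<^sup>2 = L\<^sup>2 * (\<rho> * x / y)\<^sup>2"
      using y by (simp add: power2_eq_square)
    finally show ?thesis by (simp add: s_def x_def y_def)
  qed
  show "Dvar_sq \<mu>0 \<mu>1 \<le> ennreal ((ln (b / \<sigma>1) - ln (a / \<sigma>0))\<^sup>2 / 2)"
    unfolding L_def[symmetric]
  proof (rule Dvar_sq_le[OF acm _ _ acs _ _ _ speed])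
    show "s t > 0" for t unfolding s_def using E[of t] \<rho>(1) by (intro divide_pos_pos mult_pos_pos)
  qed (use w0 w1 s0 s1 mean v in auto)
  have "ln (a\<^sup>2 + \<sigma>0\<^sup>2) + ln b = ln (b\<^sup>2 + \<sigma>1\<^sup>2) + ln a"
    using arg_cong[OF circle, of ln] nz' ab by (simp add: ln_mult add_nonneg_eq_0_iff)
  then have "busemann \<xi> (mean \<mu>1) \<sigma>1 - busemann \<xi> (mean \<mu>0) \<sigma>0 = L"
    using ab pos e by (simp add: busemann_def mean L_def ln_div)
  then show "ennreal ((ln (b / \<sigma>1) - ln (a / \<sigma>0))\<^sup>2 / 2) \<le> Dvar_sq \<mu>0 \<mu>1"
    using Dvar_sq_ge_busemann[OF v pos, of \<xi>] by (simp add: L_def)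
qed

lemma arcosh_cosh_square: "(arcosh (cosh x))\<^sup>2 = (x::real)\<^sup>2"
  using arcosh_cosh_real[of "\<bar>x\<bar>"] by simp

text \<open>The distance formula of the half-space model: the right-hand side is half the squared hyperbolic
  distance of \<open>(mean \<mu>0, \<sigma>0)\<close> and \<open>(mean \<mu>1, \<sigma>1)\<close>.\<close>
theorem Dvar_sq_eq_arcosh:
  assumes v: "var \<mu>0 = \<sigma>0\<^sup>2" "var \<mu>1 = \<sigma>1\<^sup>2" and pos: "\<sigma>0 > 0" "\<sigma>1 > 0"
    and n: "n = norm (mean \<mu>1 - mean \<mu>0)"
  shows "Dvar_sq \<mu>0 \<mu>1 = ennreal ((arcosh ((\<sigma>0\<^sup>2 + \<sigma>1\<^sup>2 + n\<^sup>2) / (2 * \<sigma>0 * \<sigma>1)))\<^sup>2 / 2)"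
proof (cases "n = 0")
  case True
  have "cosh (ln \<sigma>1 - ln \<sigma>0) = (\<sigma>0\<^sup>2 + \<sigma>1\<^sup>2 + n\<^sup>2) / (2 * \<sigma>0 * \<sigma>1)"
    using pos True by (simp add: cosh_def exp_diff exp_minus field_simps power2_eq_square)
  then show ?thesis
    using Dvar_sq_vertical[OF v pos] n True arcosh_cosh_square[of "ln \<sigma>1 - ln \<sigma>0"] by simp
next
  case False
  then have n0: "n > 0" using n by simp
  \<comment> \<open>The semicircle through both points is centred on the boundary at signed distance \<open>p / 2\<close> from
    \<open>mean \<mu>0\<close> towards \<open>mean \<mu>1\<close>; \<open>a\<close> is its radius minus \<open>p / 2\<close>.\<close>
  define p where "p = (n\<^sup>2 + \<sigma>1\<^sup>2 - \<sigma>0\<^sup>2) / n"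
  define a where "a = (sqrt (p\<^sup>2 + 4 * \<sigma>0\<^sup>2) - p) / 2"
  define b where "b = a + n"
  have "sqrt (p\<^sup>2) < sqrt (p\<^sup>2 + 4 * \<sigma>0\<^sup>2)" using pos by (intro real_sqrt_less_mono) simp
  then have a: "a > 0" by (simp add: a_def)
  then have b: "b > 0" using n0 by (simp add: b_def)
  have "2 * a + p = sqrt (p\<^sup>2 + 4 * \<sigma>0\<^sup>2)" by (simp add: a_def field_simps)
  then have "(2 * a + p)\<^sup>2 = p\<^sup>2 + 4 * \<sigma>0\<^sup>2" by simp
  then have "a\<^sup>2 + a * p = \<sigma>0\<^sup>2" by (simp add: power2_eq_square algebra_simps)
  then have "n * a\<^sup>2 + a * (n * p) = n * \<sigma>0\<^sup>2" by algebra
  moreover have "n * p = n\<^sup>2 + \<sigma>1\<^sup>2 - \<sigma>0\<^sup>2" using n0 by (simp add: p_def)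
  ultimately have root: "n * a\<^sup>2 + a * (n\<^sup>2 + \<sigma>1\<^sup>2 - \<sigma>0\<^sup>2) = n * \<sigma>0\<^sup>2" by simp
  have circle: "(a\<^sup>2 + \<sigma>0\<^sup>2) * b = (b\<^sup>2 + \<sigma>1\<^sup>2) * a"
    using root unfolding b_def by algebra
  \<comment> \<open>what \<open>2 cosh L = exp L + exp (- L)\<close> needs in order to equal the claimed value\<close>
  have key: "b\<^sup>2 * \<sigma>0\<^sup>2 + a\<^sup>2 * \<sigma>1\<^sup>2 = a * b * (\<sigma>0\<^sup>2 + \<sigma>1\<^sup>2 + n\<^sup>2)"
    using root unfolding b_def by algebra
  define e where "e = (1 / n) *\<^sub>R (mean \<mu>1 - mean \<mu>0)"
  define \<xi> where "\<xi> = mean \<mu>0 - a *\<^sub>R e"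
  have e: "norm e = 1" using n n0 by (simp add: e_def)
  have ne: "n *\<^sub>R e = mean \<mu>1 - mean \<mu>0" using n0 by (simp add: e_def)
  have mean: "mean \<mu>0 = \<xi> + a *\<^sub>R e" "mean \<mu>1 = \<xi> + b *\<^sub>R e"
    using ne by (auto simp: \<xi>_def b_def scaleR_add_left algebra_simps)
  define L where "L = ln (b / \<sigma>1) - ln (a / \<sigma>0)"
  have "exp L = b * \<sigma>0 / (a * \<sigma>1)" "exp (- L) = a * \<sigma>1 / (b * \<sigma>0)"
    using a b pos by (simp_all add: L_def exp_diff)
  then have "cosh L = (b * \<sigma>0 / (a * \<sigma>1) + a * \<sigma>1 / (b * \<sigma>0)) / 2"
    by (simp add: cosh_def)
  also have "\<dots> = (b\<^sup>2 * \<sigma>0\<^sup>2 + a\<^sup>2 * \<sigma>1\<^sup>2) / (2 * (a * b) * (\<sigma>0 * \<sigma>1))"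
    using a b pos by (simp add: field_simps power2_eq_square)
  also have "\<dots> = (\<sigma>0\<^sup>2 + \<sigma>1\<^sup>2 + n\<^sup>2) / (2 * \<sigma>0 * \<sigma>1)"
    unfolding key using a b by simp
  finally show ?thesis
    using Dvar_sq_semicircle[OF v pos e a b mean circle] arcosh_cosh_square[of L]
    by (simp add: L_def)
qed

section \<open>Asymptotics of the distance formula\<close>

text \<open>Differentiability of \<open>f'\<close> at the single point \<open>a\<close> bounds \<open>f' z - f' a\<close> by a multiple of \<open>z - a\<close>,
  and the mean value theorem turns this into a quadratic bound.\<close>
lemma bigo_first_order_remainder:
  fixes f f' :: "real \<Rightarrow> real"
  assumes deriv: "\<forall>\<^sub>F x in nhds a. (f has_real_derivative f' x) (at x)"
    and deriv2: "(f' has_real_derivative d) (at a)"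
  shows "(\<lambda>y. f (a + y) - f a - f' a * y) \<in> O[at_right 0](\<lambda>y. y\<^sup>2)"
proof -
  obtain r1 where r1: "r1 > 0" "\<And>x. dist x a < r1 \<Longrightarrow> (f has_real_derivative f' x) (at x)"
    using deriv unfolding eventually_nhds_metric by blast
  have "((\<lambda>x. (f' x - f' a) / (x - a)) \<longlongrightarrow> d) (at a)"
    using deriv2 by (simp add: has_field_derivative_iff)
  then have "\<forall>\<^sub>F x in at a. dist ((f' x - f' a) / (x - a)) d < 1"
    by (rule tendstoD) simp
  then obtain r2 where r2: "r2 > 0" "\<And>x. x \<noteq> a \<Longrightarrow> dist x a < r2 \<Longrightarrow> dist ((f' x - f' a) / (x - a)) d < 1"
    unfolding eventually_at by auto
  have "norm (f (a + y) - f a - f' a * y) \<le> (\<bar>d\<bar> + 1) * norm (y\<^sup>2)" if y: "0 < y" "y < min r1 r2" for y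
  proof -
    have "\<exists>z. a < z \<and> z < a + y \<and> f (a + y) - f a = (a + y - a) * f' z"
      using y by (intro MVT2 r1(2)) (auto simp: dist_real_def)
    then obtain z where z: "a < z" "z < a + y" "f (a + y) - f a = y * f' z" by auto
    have "\<bar>(f' z - f' a) / (z - a)\<bar> \<le> \<bar>d\<bar> + 1"
      using r2(2)[of z] z y by (auto simp: dist_real_def)
    then have "\<bar>f' z - f' a\<bar> \<le> (\<bar>d\<bar> + 1) * (z - a)" using z by (simp add: abs_divide pos_divide_le_eq)
    also have "\<dots> \<le> (\<bar>d\<bar> + 1) * y" using z by (intro mult_left_mono) auto
    finally have "y * \<bar>f' z - f' a\<bar> \<le> y * ((\<bar>d\<bar> + 1) * y)" using y by (intro mult_left_mono) auto
    moreover have eq: "f (a + y) - f a - f' a * y = y * (f' z - f' a)" using z by (simp add: algebra_simps)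
    ultimately show ?thesis using y unfolding eq by (simp add: abs_mult power2_eq_square mult.left_commute)
  qed
  then show ?thesis
    by (intro bigoI[where c = "\<bar>d\<bar> + 1"]) (use r1(1) r2(1) in \<open>auto simp: eventually_at_right_field intro!: exI[of _ "min r1 r2"]\<close>)
qed

lemma arcosh_square_remainder:
  fixes A :: real
  assumes A: "A > 1"
  shows "(\<lambda>y. (arcosh (A + y))\<^sup>2 - (arcosh A)\<^sup>2 - 2 * arcosh A / sqrt (A\<^sup>2 - 1) * y) \<in> O[at_right 0](\<lambda>y. y\<^sup>2)"
proof -
  have sq1: "x\<^sup>2 > 1" if "x > 1" for x :: real using that by (simp add: one_less_power)
  have "((\<lambda>x. (arcosh x)\<^sup>2) has_real_derivative 2 * arcosh x / sqrt (x\<^sup>2 - 1)) (at x)" if "x > 1" for x :: real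
    using that by (auto intro!: derivative_eq_intros simp: field_simps)
  then have d1: "\<forall>\<^sub>F x in nhds A. ((\<lambda>x. (arcosh x)\<^sup>2) has_real_derivative 2 * arcosh x / sqrt (x\<^sup>2 - 1)) (at x)"
    by (intro eventually_mono[OF eventually_nhds_in_open[of "{1<..}"]]) (use A in auto)
  have pos: "A\<^sup>2 - 1 > 0" using sq1[OF A] by simp
  have "((\<lambda>x. x\<^sup>2 - 1) has_real_derivative 2 * A) (at A)"
    by (auto intro!: derivative_eq_intros)
  note DERIV_divide[OF DERIV_cmult[OF arcosh_real_has_field_derivative[OF A]]
      DERIV_chain2[OF DERIV_real_sqrt[OF pos] this]]
  moreover have "sqrt (A\<^sup>2 - 1) \<noteq> 0" using pos by simp
  ultimately have "\<exists>d. ((\<lambda>x. 2 * arcosh x / sqrt (x\<^sup>2 - 1)) has_real_derivative d) (at A)"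
    by blast
  then obtain d where "((\<lambda>x. 2 * arcosh x / sqrt (x\<^sup>2 - 1)) has_real_derivative d) (at A)" ..
  from bigo_first_order_remainder[OF d1 this] show ?thesis .
qed

text \<open>The function \<open>arcosh\<close> has a square root singularity at \<open>1\<close>, but its square does not: in the
  variable \<open>d = arcosh (1 + y)\<close> the claim compares \<open>d\<^sup>2\<close> with \<open>2 * (cosh d - 1)\<close>, two
  functions that differ by a term of order \<open>d ^ 4\<close>, which is the order of \<open>y\<^sup>2\<close>.\<close>
lemma arcosh_square_remainder_at_1:
  "(\<lambda>y. (arcosh (1 + y))\<^sup>2 - 2 * y) \<in> O[at_right 0](\<lambda>y::real. y\<^sup>2)"
proof -
  have "(\<lambda>d::real. d\<^sup>2 - 2 * (cosh d - 1)) \<in> O[at_right 0](\<lambda>d. (cosh d - 1)\<^sup>2)"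
  proof -
    have "(\<lambda>d::real. d\<^sup>2 - 2 * ((exp d + exp (- d)) / 2 - 1)) \<in> O[at_right 0](\<lambda>d. ((exp d + exp (- d)) / 2 - 1)\<^sup>2)"
      by real_asymp
    then show ?thesis by (simp add: cosh_def field_simps)
  qed
  moreover have "filterlim (\<lambda>y::real. arcosh (1 + y)) (at_right 0) (at_right 0)"
  proof (rule filterlim_at_withinI)
    have "((\<lambda>y::real. 1 + y) \<longlongrightarrow> 1) (at_right 0)" by (auto intro!: tendsto_eq_intros)
    moreover have "\<forall>\<^sub>F y::real in at_right 0. 1 \<le> 1 + y"
      using eventually_at_right_less[of "0::real"] by eventually_elim simp
    ultimately have "((\<lambda>y::real. arcosh (1 + y)) \<longlongrightarrow> arcosh 1) (at_right 0)"
      by (intro tendsto_arcosh_strong) auto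
    then show "((\<lambda>y::real. arcosh (1 + y)) \<longlongrightarrow> 0) (at_right 0)" by simp
    show "\<forall>\<^sub>F y::real in at_right 0. arcosh (1 + y) \<in> {0<..} - {0}"
      using eventually_at_right_less[of "0::real"]
      by eventually_elim (simp add: arcosh_real_gt_1_iff)
  qed
  ultimately have *: "(\<lambda>y::real. (arcosh (1 + y))\<^sup>2 - 2 * (cosh (arcosh (1 + y)) - 1))
      \<in> O[at_right 0](\<lambda>y. (cosh (arcosh (1 + y)) - 1)\<^sup>2)"
    by (rule landau_o.big.compose)
  have "\<forall>\<^sub>F y :: real in at_right 0. cosh (arcosh (1 + y)) = 1 + y"
    using eventually_at_right_less[of "0::real"]
    by eventually_elim (simp add: cosh_arcosh_real)
  then have "\<forall>\<^sub>F y :: real in at_right 0. (arcosh (1 + y))\<^sup>2 - 2 * (cosh (arcosh (1 + y)) - 1) = (arcosh (1 + y))\<^sup>2 - 2 * y"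
    "\<forall>\<^sub>F y :: real in at_right 0. (cosh (arcosh (1 + y)) - 1)\<^sup>2 = y\<^sup>2"
    by (eventually_elim, simp)+
  from landau_o.big.cong_ex[OF this] * show ?thesis by blast
qed

text \<open>With \<open>A = (p + n\<^sup>2) / q\<close>, the number \<open>u = exp (- arcosh A)\<close> solves \<open>1 + u\<^sup>2 = 2 * A * u\<close>. So \<open>u\<close> is of
  order \<open>1 / n\<^sup>2\<close>, and inserting this into \<open>u = (1 + u\<^sup>2) / (2 * A)\<close> gives the leading term with an
  error of relative order \<open>1 / n\<^sup>2\<close>.\<close>
lemma exp_minus_arcosh_asymp:
  fixes p q :: real
  assumes p: "p \<ge> 0" and q: "q > 0"
  shows "(\<lambda>n. exp (- arcosh ((p + n\<^sup>2) / q)) - q / 2 / n\<^sup>2) \<in> O(\<lambda>n. 1 / n ^ 4)"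
proof (rule bigoI)
  show "\<forall>\<^sub>F n in at_top. norm (exp (- arcosh ((p + n\<^sup>2) / q)) - q / 2 / n\<^sup>2) \<le> q / 2 * (q\<^sup>2 + p) * norm (1 / n ^ 4)"
    using eventually_ge_at_top[of "max 1 q"]
  proof eventually_elim
    fix n :: real assume "max 1 q \<le> n"
    then have n: "1 \<le> n" "q \<le> n" by auto
    define A where "A = (p + n\<^sup>2) / q"
    define u where "u = exp (- arcosh A)"
    have n2: "n \<le> n\<^sup>2" using n by (simp add: power2_eq_square)
    then have A: "A \<ge> 1" using n p q by (simp add: A_def)
    have "cosh (arcosh A) = A" using A by (rule cosh_arcosh_real)
    then have "u + 1 / u = 2 * A" by (simp add: u_def cosh_def exp_minus field_simps)
    then have uA: "1 + u\<^sup>2 = 2 * A * u" by (simp add: u_def power2_eq_square field_simps)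
    have u: "0 < u" by (simp add: u_def)
    have u1: "u \<le> 1" using A by (simp add: u_def arcosh_nonneg_real)
    have "u\<^sup>2 \<le> 1" using u u1 by (intro power_le_one) auto
    moreover have "2 * (u * A) = 1 + u\<^sup>2" using uA by simp
    ultimately have "u * A \<le> 1" by linarith
    then have "u * n\<^sup>2 \<le> q"
    proof -
      have "u * n\<^sup>2 \<le> u * (p + n\<^sup>2)" using u p by (intro mult_left_mono) auto
      also have "\<dots> = q * (u * A)" using q by (simp add: A_def)
      also have "\<dots> \<le> q * 1" using q \<open>u * A \<le> 1\<close> by (intro mult_left_mono) auto
      finally show ?thesis by simp
    qed
    then have un: "u\<^sup>2 * n\<^sup>2 \<le> q\<^sup>2"
    proof -
      have "u\<^sup>2 * n\<^sup>2 \<le> u\<^sup>2 * (n\<^sup>2)\<^sup>2" using power_increasing[of 2 4 n] n by (intro mult_left_mono) auto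
      also have "\<dots> = (u * n\<^sup>2)\<^sup>2" by (simp add: power_mult_distrib)
      also have "\<dots> \<le> q\<^sup>2" using \<open>u * n\<^sup>2 \<le> q\<close> u by (intro power_mono) auto
      finally show ?thesis .
    qed
    have N: "n\<^sup>2 > 0" "p + n\<^sup>2 > 0" using n p by (auto intro: add_nonneg_pos)
    have "2 * (p + n\<^sup>2) * u = q * (1 + u\<^sup>2)" using uA q by (simp add: A_def)
    then have "u = q * (1 + u\<^sup>2) / (2 * (p + n\<^sup>2))" using N by (simp add: eq_divide_eq mult.commute)
    then have "u - q / 2 / n\<^sup>2 = q * (1 + u\<^sup>2) / (2 * (p + n\<^sup>2)) - q / 2 / n\<^sup>2" by simp
    also have "\<dots> = q / 2 * (u\<^sup>2 * n\<^sup>2 - p) / (n\<^sup>2 * (p + n\<^sup>2))"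
      using N by (simp add: divide_simps) (simp add: algebra_simps)
    finally have "\<bar>u - q / 2 / n\<^sup>2\<bar> = q / 2 * \<bar>u\<^sup>2 * n\<^sup>2 - p\<bar> / (n\<^sup>2 * (p + n\<^sup>2))"
      using N q by (simp add: abs_mult)
    also have "\<dots> \<le> q / 2 * (q\<^sup>2 + p) / (n\<^sup>2 * n\<^sup>2)"
    proof (rule frac_le)
      have "0 \<le> u\<^sup>2 * n\<^sup>2" by simp
      then have "\<bar>u\<^sup>2 * n\<^sup>2 - p\<bar> \<le> q\<^sup>2 + p" using un p by linarith
      then show "q / 2 * \<bar>u\<^sup>2 * n\<^sup>2 - p\<bar> \<le> q / 2 * (q\<^sup>2 + p)" using q by (intro mult_left_mono) auto
      show "n\<^sup>2 * n\<^sup>2 \<le> n\<^sup>2 * (p + n\<^sup>2)" using p by (intro mult_left_mono) auto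
    qed (use p q N in auto)
    also have "n\<^sup>2 * n\<^sup>2 = n ^ 4" by (simp add: power2_eq_square power4_eq_xxxx)
    finally show "norm (exp (- arcosh ((p + n\<^sup>2) / q)) - q / 2 / n\<^sup>2) \<le> q / 2 * (q\<^sup>2 + p) * norm (1 / n ^ 4)"
      using n by (simp add: u_def A_def)
  qed
qed


text \<open>With \<open>l = ln \<sigma>0 - ln \<sigma>1\<close> one has \<open>A = cosh l\<close>, and the slope \<open>arcosh A / sqrt (A\<^sup>2 - 1)\<close> of
  \<open>arcosh\<^sup>2 / 2\<close> at \<open>A\<close> is \<open>l / sinh l\<close>. This is the origin of the logarithmic quotient.\<close>
lemma log_quotient_slope:
  fixes \<sigma>0 \<sigma>1 :: real
  assumes pos: "\<sigma>0 > 0" "\<sigma>1 > 0" and ne: "\<sigma>0 \<noteq> \<sigma>1"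
  defines "A \<equiv> (\<sigma>0\<^sup>2 + \<sigma>1\<^sup>2) / (2 * \<sigma>0 * \<sigma>1)"
  shows "A > 1" and "arcosh A / sqrt (A\<^sup>2 - 1) = \<sigma>0 * \<sigma>1 * log_quotient \<sigma>0 \<sigma>1"
proof -
  have "0 < (\<sigma>0 - \<sigma>1)\<^sup>2" using ne by simp
  then show A: "A > 1" using pos by (simp add: A_def power2_diff)
  define l where "l = ln \<sigma>0 - ln \<sigma>1"
  have "cosh l = A"
    using pos by (simp add: A_def l_def cosh_def exp_diff exp_minus field_simps power2_eq_square)
  have sinh: "sinh l = (\<sigma>0\<^sup>2 - \<sigma>1\<^sup>2) / (2 * \<sigma>0 * \<sigma>1)"
    using pos by (simp add: l_def sinh_def exp_diff exp_minus field_simps power2_eq_square)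
  have "\<bar>l\<bar> = arcosh A"
    using arcosh_cosh_real[of "\<bar>l\<bar>"] \<open>cosh l = A\<close> by simp
  moreover have "sqrt (A\<^sup>2 - 1) = \<bar>sinh l\<bar>"
  proof -
    have "A\<^sup>2 - 1 = (sinh l)\<^sup>2" using cosh_square_eq[of l] by (simp add: \<open>cosh l = A\<close>)
    then show ?thesis by simp
  qed
  moreover have "\<bar>l\<bar> / \<bar>sinh l\<bar> = l / sinh l"
    by (cases "l \<ge> 0") (auto simp: abs_if sinh_real_neg_iff)
  moreover have "l / sinh l = \<sigma>0 * \<sigma>1 * log_quotient \<sigma>0 \<sigma>1"
    unfolding sinh log_quotient_def using pos ne by (simp add: l_def ln_realpow algebra_simps)
  ultimately show "arcosh A / sqrt (A\<^sup>2 - 1) = \<sigma>0 * \<sigma>1 * log_quotient \<sigma>0 \<sigma>1" by simp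
qed

text \<open>First-order expansion at \<open>A\<close> in the increment \<open>h n\<close>, which is quadratic in \<open>n\<close>. The variances
  coincide exactly when \<open>A = 1\<close>, and only then the singular point of \<open>arcosh\<close> is involved.\<close>
lemma arcosh_square_near_0:
  fixes \<sigma>0 \<sigma>1 :: real
  assumes pos: "\<sigma>0 > 0" "\<sigma>1 > 0"
  shows "(\<lambda>n. (arcosh ((\<sigma>0\<^sup>2 + \<sigma>1\<^sup>2 + n\<^sup>2) / (2 * \<sigma>0 * \<sigma>1)))\<^sup>2 / 2
      - (1 / 2 * \<bar>ln \<sigma>0 - ln \<sigma>1\<bar>\<^sup>2 + log_quotient \<sigma>0 \<sigma>1 * (n\<^sup>2 / 2))) \<in> O[nhds 0](\<lambda>n. n ^ 4)"
proof -
  define A where "A = (\<sigma>0\<^sup>2 + \<sigma>1\<^sup>2) / (2 * \<sigma>0 * \<sigma>1)"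
  define \<kappa> where "\<kappa> = 2 * \<sigma>0 * \<sigma>1 * log_quotient \<sigma>0 \<sigma>1"
  define h where "h n = n\<^sup>2 / (2 * \<sigma>0 * \<sigma>1)" for n
  define R where "R n = (arcosh ((\<sigma>0\<^sup>2 + \<sigma>1\<^sup>2 + n\<^sup>2) / (2 * \<sigma>0 * \<sigma>1)))\<^sup>2 / 2
      - (1 / 2 * \<bar>ln \<sigma>0 - ln \<sigma>1\<bar>\<^sup>2 + log_quotient \<sigma>0 \<sigma>1 * (n\<^sup>2 / 2))" for n
  have A0: "(arcosh A)\<^sup>2 = \<bar>ln \<sigma>0 - ln \<sigma>1\<bar>\<^sup>2"
  proof -
    have "cosh (ln \<sigma>0 - ln \<sigma>1) = A"
      using pos by (simp add: A_def cosh_def exp_diff exp_minus field_simps power2_eq_square)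
    then show ?thesis using arcosh_cosh_real[of "\<bar>ln \<sigma>0 - ln \<sigma>1\<bar>"] by simp
  qed
  have rem: "(\<lambda>y. (arcosh (A + y))\<^sup>2 - (arcosh A)\<^sup>2 - \<kappa> * y) \<in> O[at_right 0](\<lambda>y. y\<^sup>2)"
  proof (cases "\<sigma>0 = \<sigma>1")
    case True
    then have "A = 1" "\<kappa> = 2" using pos
      by (auto simp: A_def \<kappa>_def log_quotient_def power2_eq_square)
    then show ?thesis using arcosh_square_remainder_at_1 by simp
  next
    case False
    note slope = log_quotient_slope[OF pos False, folded A_def]
    have "\<kappa> = 2 * arcosh A / sqrt (A\<^sup>2 - 1)" using slope(2) by (simp add: \<kappa>_def)
    then show ?thesis using arcosh_square_remainder[OF slope(1)] by simp
  qed
  have "filterlim h (at_right 0) (at 0)"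
  proof (rule filterlim_at_withinI)
    show "(h \<longlongrightarrow> 0) (at 0)" unfolding h_def using pos by (auto intro!: tendsto_eq_intros)
    show "\<forall>\<^sub>F n in at 0. h n \<in> {0<..} - {0}"
      using pos by (auto simp: h_def eventually_at intro!: exI[of _ 1])
  qed
  from landau_o.big.compose[OF rem this]
  have "(\<lambda>n. (arcosh (A + h n))\<^sup>2 - (arcosh A)\<^sup>2 - \<kappa> * h n) \<in> O[at 0](\<lambda>n. (h n)\<^sup>2)" .
  moreover have "(arcosh (A + h n))\<^sup>2 - (arcosh A)\<^sup>2 - \<kappa> * h n = 2 * R n" for n
  proof -
    have "A + h n = (\<sigma>0\<^sup>2 + \<sigma>1\<^sup>2 + n\<^sup>2) / (2 * \<sigma>0 * \<sigma>1)"
      by (simp add: A_def h_def add_divide_distrib)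
    moreover have "\<kappa> * h n = log_quotient \<sigma>0 \<sigma>1 * n\<^sup>2"
      using pos unfolding \<kappa>_def h_def by (simp add: divide_simps)
    ultimately show ?thesis unfolding R_def A0 by simp
  qed
  moreover have "(\<lambda>n. (h n)\<^sup>2) \<in> O[at 0](\<lambda>n. n ^ 4)"
    by (rule bigoI[where c = "1 / (2 * \<sigma>0 * \<sigma>1)\<^sup>2"])
       (simp add: h_def power_divide flip: power_mult)
  ultimately have "(\<lambda>n. 2 * R n) \<in> O[at 0](\<lambda>n. n ^ 4)"
    using landau_o.big_trans by simp
  then have "R \<in> O[at 0](\<lambda>n. n ^ 4)" by simp
  \<comment> \<open>At \<open>n = 0\<close> itself the bound requires the remainder to vanish.\<close>
  moreover have "R 0 = 0" using A0 by (simp add: R_def A_def)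
  ultimately have "R \<in> O[nhds 0](\<lambda>n. n ^ 4)"
    unfolding bigo_def eventually_nhds_conv_at by simp
  then show ?thesis unfolding R_def .
qed

text \<open>In the second expansion the argument of the logarithm, including its remainder, is \<open>exp (- d)\<close> for
  the hyperbolic distance \<open>d\<close>. So it is positive, and the square of its logarithm is \<open>d\<^sup>2\<close>.\<close>
theorem corollary1p36:
  fixes \<sigma>0 \<sigma>1 :: real
  assumes "\<sigma>0 > 0" and "\<sigma>1 > 0"
  shows "(\<exists>R :: real \<Rightarrow> real. R \<in> O[nhds 0](\<lambda>n. n ^ 4) \<and>
      (\<forall>\<^sub>F n in nhds 0. \<forall>\<mu>0 \<mu>1 :: (real ^ 'd) measure.
         P2 \<mu>0 \<and> P2 \<mu>1 \<and> var \<mu>0 = \<sigma>0\<^sup>2 \<and> var \<mu>1 = \<sigma>1\<^sup>2 \<and> n = norm (mean \<mu>1 - mean \<mu>0) \<longrightarrow>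
         enn2ereal (Dvar_sq \<mu>0 \<mu>1) =
           ereal (1 / 2 * \<bar>ln \<sigma>0 - ln \<sigma>1\<bar>\<^sup>2 + log_quotient \<sigma>0 \<sigma>1 * (n\<^sup>2 / 2) + R n))) \<and>
    (\<exists>R :: real \<Rightarrow> real. R \<in> O[at_top](\<lambda>n. 1 / n ^ 4) \<and>
      (\<forall>\<^sub>F n in at_top. \<forall>\<mu>0 \<mu>1 :: (real ^ 'd) measure.
         P2 \<mu>0 \<and> P2 \<mu>1 \<and> var \<mu>0 = \<sigma>0\<^sup>2 \<and> var \<mu>1 = \<sigma>1\<^sup>2 \<and> n = norm (mean \<mu>1 - mean \<mu>0) \<longrightarrow>
         \<sigma>0 * \<sigma>1 / n\<^sup>2 + R n > 0 \<and>
         enn2ereal (Dvar_sq \<mu>0 \<mu>1) =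
           ereal (1 / 2 * \<bar>ln (\<sigma>0 * \<sigma>1 / n\<^sup>2 + R n)\<bar>\<^sup>2)))"
proof (intro conjI)
  define d where "d n = arcosh ((\<sigma>0\<^sup>2 + \<sigma>1\<^sup>2 + n\<^sup>2) / (2 * \<sigma>0 * \<sigma>1))" for n
  have formula: "enn2ereal (Dvar_sq \<mu>0 \<mu>1) = ereal ((d n)\<^sup>2 / 2)"
    if "var \<mu>0 = \<sigma>0\<^sup>2" "var \<mu>1 = \<sigma>1\<^sup>2" "n = norm (mean \<mu>1 - mean \<mu>0)"
    for n and \<mu>0 \<mu>1 :: "(real ^ 'd) measure"
    using Dvar_sq_eq_arcosh[OF that(1,2) assms that(3)] unfolding d_def by simp
  show "\<exists>R :: real \<Rightarrow> real. R \<in> O[nhds 0](\<lambda>n. n ^ 4) \<and>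
      (\<forall>\<^sub>F n in nhds 0. \<forall>\<mu>0 \<mu>1 :: (real ^ 'd) measure.
         P2 \<mu>0 \<and> P2 \<mu>1 \<and> var \<mu>0 = \<sigma>0\<^sup>2 \<and> var \<mu>1 = \<sigma>1\<^sup>2 \<and> n = norm (mean \<mu>1 - mean \<mu>0) \<longrightarrow>
         enn2ereal (Dvar_sq \<mu>0 \<mu>1) =
           ereal (1 / 2 * \<bar>ln \<sigma>0 - ln \<sigma>1\<bar>\<^sup>2 + log_quotient \<sigma>0 \<sigma>1 * (n\<^sup>2 / 2) + R n))"
  proof (rule exI, rule conjI[OF arcosh_square_near_0[OF assms]], intro always_eventually allI impI)
    fix n and \<mu>0 \<mu>1 :: "(real ^ 'd) measure"
    assume "P2 \<mu>0 \<and> P2 \<mu>1 \<and> var \<mu>0 = \<sigma>0\<^sup>2 \<and> var \<mu>1 = \<sigma>1\<^sup>2 \<and> n = norm (mean \<mu>1 - mean \<mu>0)"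
    then show "enn2ereal (Dvar_sq \<mu>0 \<mu>1) =
        ereal (1 / 2 * \<bar>ln \<sigma>0 - ln \<sigma>1\<bar>\<^sup>2 + log_quotient \<sigma>0 \<sigma>1 * (n\<^sup>2 / 2) +
          ((arcosh ((\<sigma>0\<^sup>2 + \<sigma>1\<^sup>2 + n\<^sup>2) / (2 * \<sigma>0 * \<sigma>1)))\<^sup>2 / 2
            - (1 / 2 * \<bar>ln \<sigma>0 - ln \<sigma>1\<bar>\<^sup>2 + log_quotient \<sigma>0 \<sigma>1 * (n\<^sup>2 / 2))))"
      using formula[of \<mu>0 \<mu>1 n] by (simp add: d_def)
  qed
  define R where "R n = exp (- d n) - \<sigma>0 * \<sigma>1 / n\<^sup>2" for n
  have "R \<in> O(\<lambda>n. 1 / n ^ 4)"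
    using exp_minus_arcosh_asymp[of "\<sigma>0\<^sup>2 + \<sigma>1\<^sup>2" "2 * \<sigma>0 * \<sigma>1"] assms
    by (simp add: R_def[abs_def] d_def)
  moreover have "\<sigma>0 * \<sigma>1 / n\<^sup>2 + R n = exp (- d n)" for n by (simp add: R_def)
  moreover have "1 / 2 * \<bar>ln (exp (- d n))\<bar>\<^sup>2 = (d n)\<^sup>2 / 2" for n by simp
  ultimately show "\<exists>R :: real \<Rightarrow> real. R \<in> O[at_top](\<lambda>n. 1 / n ^ 4) \<and>
      (\<forall>\<^sub>F n in at_top. \<forall>\<mu>0 \<mu>1 :: (real ^ 'd) measure.
         P2 \<mu>0 \<and> P2 \<mu>1 \<and> var \<mu>0 = \<sigma>0\<^sup>2 \<and> var \<mu>1 = \<sigma>1\<^sup>2 \<and> n = norm (mean \<mu>1 - mean \<mu>0) \<longrightarrow>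
         \<sigma>0 * \<sigma>1 / n\<^sup>2 + R n > 0 \<and>
         enn2ereal (Dvar_sq \<mu>0 \<mu>1) =
           ereal (1 / 2 * \<bar>ln (\<sigma>0 * \<sigma>1 / n\<^sup>2 + R n)\<bar>\<^sup>2))"
    by (intro exI[of _ R] conjI always_eventually allI impI) (simp_all add: formula del: ln_exp abs_minus_cancel)
qed

end
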